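(* For each countable non-locally finite group $G$ there is a projection $p \in \ell^\infty(G,\mathcal{K})$ satisfying: (i) $p$ is properly infinite in the Roe algebra $\ell^\infty(G,\mathcal{K}) \rtimes G$. (ii) There is no trace $\tau$ on the Roe algebra $\ell^\infty(G,\mathcal{K}) \rtimes G$ with $\tau(p)=1$. (iii) Each trace on $\ell^\infty(G,\mathcal{K})$ is either unbounded or zero on the orbit $\{t.p\}_{t \in G}$.
   Context: $\mathcal{K}$ is the $C^*$-algebra of compact operators on a separable infinite dimensional Hilbert space, and $\ell^\infty(G,\mathcal{K})$ is the $C^*$-algebra of bounded functions $G \to \mathcal{K}$, with $G$ acting by left-translation, $(t.f)(s)=f(t^{-1}s)$; $\ell^\infty(G,\mathcal{K}) \rtimes G$ is the reduced crossed product. A group is locally finite if each finitely generated subgroup is finite. A non-zero projection $p$ in a $C^*$-algebra $\mathcal{B}$ is properly infinite if there are mutually orthogonal projections $p_1,p_2 \le p$ in $\mathcal{B}$, each Murray–von Neumann equivalent to $p$. A trace on a $C^*$-algebra $\mathcal{A}$ is an additive, (positively) homogeneous map $\tau \colon \mathcal{A}^+ \to [0,\infty]$ with $\tau(x^*x)=\tau(xx^* )$ for all $x \in \mathcal{A}$ (no lower semi-continuity assumed). In (iii): either $\sup_{t\in G}\tau(t.p) = \infty$ or $\tau(t.p)=0$ for all $t \in G$. *)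

theory Defs
  imports "HOL-Analysis.Analysis" "HOL-Library.Function_Algebras"
begin

subsection \<open>The complex Hilbert space of square-summable functions\<close>

definition square_summable :: "('x \<Rightarrow> complex) \<Rightarrow> bool" where
  "square_summable f \<longleftrightarrow> (\<lambda>x. (cmod (f x))\<^sup>2) summable_on UNIV"

lemma summable_on_nonneg_comparison:
  fixes f g :: "'x \<Rightarrow> real"
  assumes "g summable_on A" "\<And>x. 0 \<le> f x" "\<And>x. f x \<le> g x"
  shows "f summable_on A"
proof -
  have g: "(\<lambda>x. norm (g x)) summable_on A"
    using assms by (subst summable_on_iff_abs_summable_on_real[symmetric]) auto
  have "(\<lambda>x. norm (f x)) summable_on A"
    by (rule Infinite_Sum.abs_summable_on_comparison_test[OF g]) (use assms in \<open>auto simp: order_trans[OF assms(2,3)]\<close>)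
  then show ?thesis
    by (rule abs_summable_summable)
qed

lemma square_summable_zero: "square_summable (\<lambda>_. 0)"
  by (simp add: square_summable_def)

lemma square_summable_add:
  assumes "square_summable f" "square_summable g"
  shows "square_summable (\<lambda>x. f x + g x)"
  unfolding square_summable_def
proof (rule summable_on_nonneg_comparison)
  show "(\<lambda>x. 2 * (cmod (f x))\<^sup>2 + 2 * (cmod (g x))\<^sup>2) summable_on UNIV"
    using assms unfolding square_summable_def
    by (intro summable_on_add summable_on_cmult_right)
  fix x
  have "(cmod (f x + g x))\<^sup>2 \<le> (cmod (f x) + cmod (g x))\<^sup>2"
    by (intro power_mono norm_triangle_ineq) simp
  also have "\<dots> \<le> 2 * (cmod (f x))\<^sup>2 + 2 * (cmod (g x))\<^sup>2"
    using sum_squares_bound[of "cmod (f x)" "cmod (g x)"] by (simp add: power2_sum)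
  finally show "(cmod (f x + g x))\<^sup>2 \<le> 2 * (cmod (f x))\<^sup>2 + 2 * (cmod (g x))\<^sup>2" .
qed simp

lemma square_summable_mult:
  assumes "square_summable f"
  shows "square_summable (\<lambda>x. c * f x)"
  using assms unfolding square_summable_def
  by (simp add: norm_mult power_mult_distrib summable_on_cmult_right)

lemma square_summable_minus: "square_summable f \<Longrightarrow> square_summable (\<lambda>x. - f x)"
  by (simp add: square_summable_def)

lemma square_summable_diff:
  "square_summable f \<Longrightarrow> square_summable g \<Longrightarrow> square_summable (\<lambda>x. f x - g x)"
  using square_summable_add[of f "\<lambda>x. - g x"] square_summable_minus[of g] by simp

lemma square_summable_scaleR: "square_summable f \<Longrightarrow> square_summable (\<lambda>x. r *\<^sub>R f x)"
  using square_summable_mult[of f "of_real r"] by (simp add: scaleR_conv_of_real)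

lemma square_summable_abs_product:
  assumes "square_summable f" "square_summable g"
  shows "(\<lambda>x. cmod (f x) * cmod (g x)) summable_on UNIV"
proof (rule summable_on_nonneg_comparison)
  show "(\<lambda>x. (cmod (f x))\<^sup>2 + (cmod (g x))\<^sup>2) summable_on UNIV"
    using assms unfolding square_summable_def by (intro summable_on_add)
  show "cmod (f x) * cmod (g x) \<le> (cmod (f x))\<^sup>2 + (cmod (g x))\<^sup>2" for x
    using sum_squares_bound[of "cmod (f x)" "cmod (g x)"]
      mult_nonneg_nonneg[OF norm_ge_zero norm_ge_zero, of "f x" "g x"] by linarith
qed simp

lemma square_summable_product:
  assumes "square_summable f" "square_summable g"
  shows "(\<lambda>x. cnj (f x) * g x) summable_on UNIV"
  by (rule abs_summable_summable) (use square_summable_abs_product[OF assms] in \<open>simp add: norm_mult\<close>)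

lemma square_summable_inner:
  assumes "square_summable f" "square_summable g"
  shows "(\<lambda>x. inner (f x) (g x)) summable_on UNIV"
proof -
  have "inner (f x) (g x) = Re (cnj (f x) * g x)" for x
    by (simp add: inner_complex_def)
  then show ?thesis
    using summable_on_Re[OF square_summable_product[OF assms]] by simp
qed

typedef 'x ell2 = "{f :: 'x \<Rightarrow> complex. square_summable f}"
  morphisms ell2_apply Abs_ell2
  using square_summable_zero by blast

setup_lifting type_definition_ell2

lemma square_summable_ell2 [simp]: "square_summable (ell2_apply f)"
  using ell2_apply by blast

lemma ell2_eqI: "(\<And>x. ell2_apply f x = ell2_apply g x) \<Longrightarrow> f = g"
  by (metis ell2_apply_inject ext)

instantiation ell2 :: (type) real_inner
begin

lift_definition zero_ell2 :: "'a ell2" is "\<lambda>_. 0" by (rule square_summable_zero)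
lift_definition plus_ell2 :: "'a ell2 \<Rightarrow> 'a ell2 \<Rightarrow> 'a ell2" is "\<lambda>f g x. f x + g x"
  by (rule square_summable_add)
lift_definition uminus_ell2 :: "'a ell2 \<Rightarrow> 'a ell2" is "\<lambda>f x. - f x"
  by (rule square_summable_minus)
lift_definition minus_ell2 :: "'a ell2 \<Rightarrow> 'a ell2 \<Rightarrow> 'a ell2" is "\<lambda>f g x. f x - g x"
  by (rule square_summable_diff)
lift_definition scaleR_ell2 :: "real \<Rightarrow> 'a ell2 \<Rightarrow> 'a ell2" is "\<lambda>r f x. r *\<^sub>R f x"
  by (rule square_summable_scaleR)
lift_definition inner_ell2 :: "'a ell2 \<Rightarrow> 'a ell2 \<Rightarrow> real"
  is "\<lambda>f g. \<Sum>\<^sub>\<infinity>x. inner (f x) (g x)" .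
definition norm_ell2 :: "'a ell2 \<Rightarrow> real" where "norm_ell2 f = sqrt (inner f f)"
definition dist_ell2 :: "'a ell2 \<Rightarrow> 'a ell2 \<Rightarrow> real" where "dist_ell2 f g = norm (f - g)"
definition sgn_ell2 :: "'a ell2 \<Rightarrow> 'a ell2" where "sgn_ell2 f = scaleR (inverse (norm f)) f"
definition uniformity_ell2 :: "('a ell2 \<times> 'a ell2) filter"
  where "uniformity_ell2 = (INF e\<in>{0<..}. principal {(f, g). dist f g < e})"
definition open_ell2 :: "'a ell2 set \<Rightarrow> bool"
  where "open_ell2 U \<longleftrightarrow> (\<forall>f\<in>U. \<forall>\<^sub>F (f', g) in uniformity. f' = f \<longrightarrow> g \<in> U)"

instance
proof
  fix f g h :: "'a ell2" and r s :: real and U :: "'a ell2 set"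
  show "f + g + h = f + (g + h)" by transfer (simp add: add.assoc)
  show "f + g = g + f" by transfer (simp add: add.commute)
  show "0 + f = f" by transfer simp
  show "- f + f = 0" by transfer simp
  show "f - g = f + - g" by transfer simp
  show "r *\<^sub>R (f + g) = r *\<^sub>R f + r *\<^sub>R g" by transfer (simp add: scaleR_add_right)
  show "(r + s) *\<^sub>R f = r *\<^sub>R f + s *\<^sub>R f" by transfer (simp add: scaleR_add_left)
  show "r *\<^sub>R s *\<^sub>R f = (r * s) *\<^sub>R f" by transfer simp
  show "1 *\<^sub>R f = f" by transfer simp
  show "sgn f = scaleR (inverse (norm f)) f" by (rule sgn_ell2_def)
  show "dist f g = norm (f - g)" by (rule dist_ell2_def)
  show "uniformity = (INF e\<in>{0<..}. principal {(f :: 'a ell2, g). dist f g < e})"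
    by (rule uniformity_ell2_def)
  show "open U \<longleftrightarrow> (\<forall>f\<in>U. \<forall>\<^sub>F (f', g) in uniformity. f' = f \<longrightarrow> g \<in> U)"
    by (rule open_ell2_def)
  show "inner f g = inner g f" by transfer (simp add: inner_commute)
  show "inner (f + g) h = inner f h + inner g h"
    by transfer (simp add: inner_add_left infsum_add square_summable_inner)
  show "inner (r *\<^sub>R f) g = r * inner f g"
    by transfer (simp add: infsum_cmult_right')
  show "0 \<le> inner f f"
    by transfer (simp add: infsum_nonneg)
  show "inner f f = 0 \<longleftrightarrow> f = 0"
  proof
    assume "inner f f = 0"
    then show "f = 0"
    proof transfer
      fix f :: "'a \<Rightarrow> complex"
      assume f: "square_summable f" and 0: "(\<Sum>\<^sub>\<infinity>x. inner (f x) (f x)) = 0"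
      have "inner (f x) (f x) = 0" for x
        by (rule nonneg_infsum_le_0D[where A = UNIV]) (use 0 square_summable_inner[OF f f] in auto)
      then show "f = (\<lambda>_. 0)" by auto
    qed
  qed (transfer, simp)
  show "norm f = sqrt (inner f f)" by (rule norm_ell2_def)
qed

end

lemma norm_ell2_square: "(norm f)\<^sup>2 = (\<Sum>\<^sub>\<infinity>x. (cmod (ell2_apply f x))\<^sup>2)"
  by (simp only: power2_norm_eq_inner inner_ell2.rep_eq)

lift_definition scaleC :: "complex \<Rightarrow> 'x ell2 \<Rightarrow> 'x ell2" (infixr "*\<^sub>C" 75)
  is "\<lambda>c f x. c * f x" by (rule square_summable_mult)

text \<open>Conjugate-linear in the first argument.\<close>

lift_definition cinner :: "'x ell2 \<Rightarrow> 'x ell2 \<Rightarrow> complex"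
  is "\<lambda>f g. \<Sum>\<^sub>\<infinity>x. cnj (f x) * g x" .

lemma inner_eq_Re_cinner: "inner f g = Re (cinner f g)"
proof transfer
  fix f g :: "'a \<Rightarrow> complex" assume "square_summable f" "square_summable g"
  from infsum_Re[OF square_summable_product[OF this]]
  show "(\<Sum>\<^sub>\<infinity>x. f x \<bullet> g x) = Re (\<Sum>\<^sub>\<infinity>x. cnj (f x) * g x)"
    by (simp add: inner_complex_def)
qed

lemma cinner_add_left: "cinner (f + g) h = cinner f h + cinner g h"
  by transfer (simp add: distrib_right infsum_add square_summable_product)
lemma cinner_add_right: "cinner f (g + h) = cinner f g + cinner f h"
  by transfer (simp add: distrib_left infsum_add square_summable_product)
lemma cinner_scaleC_left: "cinner (c *\<^sub>C f) g = cnj c * cinner f g"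
  by transfer (simp add: infsum_cmult_right' mult.assoc)
lemma cinner_scaleC_right: "cinner f (c *\<^sub>C g) = c * cinner f g"
  by transfer (simp add: infsum_cmult_right'[symmetric] algebra_simps)
lemma cinner_commute: "cinner f g = cnj (cinner g f)"
  by transfer (simp add: infsum_cnj[symmetric] mult.commute)
lemma scaleR_scaleC: "r *\<^sub>R f = of_real r *\<^sub>C f"
  by transfer (simp add: scaleR_conv_of_real)
lemma norm_scaleC: "norm (c *\<^sub>C f) = cmod c * norm f"
proof -
  have "(norm (c *\<^sub>C f))\<^sup>2 = (cmod c * norm f)\<^sup>2"
    unfolding norm_ell2_square power_mult_distrib
    by (simp add: scaleC.rep_eq norm_mult power_mult_distrib infsum_cmult_right')
  then show ?thesis by (simp add: power2_eq_iff_nonneg)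
qed
lemma scaleC_add_right: "c *\<^sub>C (f + g) = c *\<^sub>C f + c *\<^sub>C g"
  by transfer (simp add: distrib_left)
lemma scaleC_scaleC: "c *\<^sub>C d *\<^sub>C f = (c * d) *\<^sub>C f"
  by transfer (simp add: mult.assoc)

lemma cinner_eq_inner: "cinner f g = Complex (inner f g) (inner (\<i> *\<^sub>C f) g)"
  by (simp add: inner_eq_Re_cinner cinner_scaleC_left complex_eq_iff)

lemma norm_cinner_le: "cmod (cinner f g) \<le> norm f * norm g"
proof (cases "cinner f g = 0")
  case False
  define c where "c = cinner f g / of_real (cmod (cinner f g))"
  have c: "cmod c = 1" using False by (simp add: c_def norm_divide)
  have "cnj c * cinner f g = of_real (cmod (cinner f g))"
    using False by (simp add: c_def complex_norm_square[symmetric] power2_eq_square mult.commute)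
  then have "cmod (cinner f g) = inner (c *\<^sub>C f) g"
    by (simp add: inner_eq_Re_cinner cinner_scaleC_left)
  also have "\<dots> \<le> norm (c *\<^sub>C f) * norm g" by (rule norm_cauchy_schwarz)
  finally show ?thesis by (simp add: norm_scaleC c)
qed simp

lemma cinner_eqI: "(\<And>h. cinner h f = cinner h g) \<Longrightarrow> f = g"
proof -
  assume "\<And>h. cinner h f = cinner h g"
  then have "inner h f = inner h g" for h by (simp add: inner_eq_Re_cinner)
  then have "inner h (f - g) = 0" for h by (simp add: inner_diff_right)
  then show "f = g" using inner_eq_zero_iff[of "f - g"] by auto
qed

lemma finite_sum_le_norm_ell2: "finite F \<Longrightarrow> (\<Sum>x\<in>F. (cmod (ell2_apply f x))\<^sup>2) \<le> (norm f)\<^sup>2"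
  unfolding norm_ell2_square
  by (rule finite_sum_le_infsum) (use square_summable_ell2[of f] in \<open>auto simp: square_summable_def\<close>)

lemma cmod_ell2_apply_le: "cmod (ell2_apply f x) \<le> norm f"
  using finite_sum_le_norm_ell2[of "{x}" f] by (simp add: power_mono_iff)

lemma square_summable_boundedI:
  assumes "\<And>F. finite F \<Longrightarrow> (\<Sum>x\<in>F. (cmod (f x))\<^sup>2) \<le> B"
  shows "square_summable f"
  unfolding square_summable_def
  by (rule nonneg_bdd_above_summable_on) (use assms in \<open>auto simp: bdd_above_def\<close>)

lemma norm_ell2_boundedI:
  assumes "\<And>F. finite F \<Longrightarrow> (\<Sum>x\<in>F. (cmod (ell2_apply f x))\<^sup>2) \<le> B\<^sup>2" "0 \<le> B"
  shows "norm f \<le> B"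
proof -
  have "(norm f)\<^sup>2 \<le> B\<^sup>2"
    unfolding norm_ell2_square
    by (rule infsum_le_finite_sums) (use assms square_summable_ell2[of f] in \<open>auto simp: square_summable_def\<close>)
  then show ?thesis using assms(2) by (simp add: power_mono_iff)
qed

instance ell2 :: (type) complete_space
proof
  fix X :: "nat \<Rightarrow> 'a ell2"
  assume X: "Cauchy X"
  have ap: "ell2_apply (u - v) x = ell2_apply u x - ell2_apply v x" for u v :: "'a ell2" and x
    by (simp add: minus_ell2.rep_eq)
  have "convergent (\<lambda>n. ell2_apply (X n) x)" for x
  proof (rule Cauchy_convergent, rule metric_CauchyI)
    fix e :: real assume "e > 0"
    then obtain M where M: "\<And>m n. m \<ge> M \<Longrightarrow> n \<ge> M \<Longrightarrow> dist (X m) (X n) < e"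
      using X unfolding Cauchy_def by blast
    then show "\<exists>M. \<forall>m\<ge>M. \<forall>n\<ge>M. dist (ell2_apply (X m) x) (ell2_apply (X n) x) < e"
      using cmod_ell2_apply_le[of "X _ - X _" x] unfolding dist_norm ap
      by (meson le_less_trans)
  qed
  then obtain l where l: "\<And>x. (\<lambda>n. ell2_apply (X n) x) \<longlonglongrightarrow> l x"
    unfolding convergent_def by metis
  have key: "(\<Sum>x\<in>F. (cmod (l x - ell2_apply (X n) x))\<^sup>2) \<le> e\<^sup>2"
    if M: "\<And>m. m \<ge> n \<Longrightarrow> norm (X m - X n) \<le> e" and F: "finite F" for F n e
  proof (rule LIMSEQ_le_const2)
    show "(\<lambda>m. \<Sum>x\<in>F. (cmod (ell2_apply (X m) x - ell2_apply (X n) x))\<^sup>2)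
        \<longlonglongrightarrow> (\<Sum>x\<in>F. (cmod (l x - ell2_apply (X n) x))\<^sup>2)"
      by (intro tendsto_intros l)
    have "(\<Sum>x\<in>F. (cmod (ell2_apply (X m) x - ell2_apply (X n) x))\<^sup>2) \<le> e\<^sup>2" if "m \<ge> n" for m
      using order_trans[OF finite_sum_le_norm_ell2[OF F, of "X m - X n"] power_mono[OF M[OF that], of 2]]
      by (simp add: ap)
    then show "\<exists>N. \<forall>m\<ge>N. (\<Sum>x\<in>F. (cmod (ell2_apply (X m) x - ell2_apply (X n) x))\<^sup>2) \<le> e\<^sup>2"
      by blast
  qed
  have cau: "\<exists>n. \<forall>k\<ge>n. \<forall>m\<ge>k. norm (X m - X k) \<le> e" if e: "e > 0" for e
  proof -
    obtain n where "\<And>m k. m \<ge> n \<Longrightarrow> k \<ge> n \<Longrightarrow> dist (X m) (X k) < e"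
      using X e unfolding Cauchy_def by blast
    then show ?thesis by (intro exI[of _ n]) (auto simp: dist_norm less_imp_le)
  qed
  obtain n1 where "\<forall>k\<ge>n1. \<forall>m\<ge>k. norm (X m - X k) \<le> 1" using cau[of 1] by auto
  then have "square_summable (\<lambda>x. l x - ell2_apply (X n1) x)"
    by (intro square_summable_boundedI[of _ "1\<^sup>2"] key) auto
  from square_summable_add[OF this square_summable_ell2[of "X n1"]]
  have sl: "square_summable l" by simp
  define L where "L = Abs_ell2 l"
  have L: "ell2_apply L = l" unfolding L_def using sl by (simp add: Abs_ell2_inverse)
  have "X \<longlonglongrightarrow> L"
  proof (rule metric_LIMSEQ_I)
    fix r :: real assume "r > 0"
    then obtain n where n: "\<forall>k\<ge>n. \<forall>m\<ge>k. norm (X m - X k) \<le> r / 2" using cau[of "r/2"] by auto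
    have "norm (L - X k) \<le> r / 2" if "k \<ge> n" for k
      by (rule norm_ell2_boundedI) (use key[of k "r/2"] n that \<open>r > 0\<close> in \<open>auto simp: ap L\<close>)
    then have "dist (X k) L < r" if "k \<ge> n" for k
      using that \<open>r > 0\<close> by (metis dist_commute dist_norm field_sum_of_halves le_less_trans less_add_same_cancel1 half_gt_zero)
    then show "\<exists>no. \<forall>n\<ge>no. dist (X n) L < r" by blast
  qed
  then show "convergent X" by (auto simp: convergent_def)
qed

instance ell2 :: (type) banach ..

lemma scaleC_linear_simps:
  "c *\<^sub>C (0 :: 'x ell2) = 0" "c *\<^sub>C (f + g) = c *\<^sub>C f + c *\<^sub>C g" "c *\<^sub>C (- f) = - (c *\<^sub>C f)"
  "c *\<^sub>C (f - g) = c *\<^sub>C f - c *\<^sub>C g" "c *\<^sub>C (r *\<^sub>R f) = r *\<^sub>R (c *\<^sub>C f)"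
  for f g :: "'x ell2"
  by (transfer; simp add: algebra_simps scaleR_conv_of_real)+

lift_definition unit_vec :: "'x \<Rightarrow> 'x ell2" is "\<lambda>a x. if x = a then 1 else 0"
proof (rule square_summable_boundedI)
  fix a :: 'x and F :: "'x set" assume "finite F"
  then show "(\<Sum>x\<in>F. (cmod (if x = a then 1 else 0))\<^sup>2) \<le> 1"
    by (simp add: if_distrib[of cmod] if_distrib[of "\<lambda>z. z\<^sup>2"] cong: if_cong)
qed

lemma ell2_apply_sum: "ell2_apply (sum f F) x = (\<Sum>i\<in>F. ell2_apply (f i) x)"
  by (induction F rule: infinite_finite_induct) (auto simp: zero_ell2.rep_eq plus_ell2.rep_eq)

lemma cinner_unit_vec: "cinner (unit_vec a) f = ell2_apply f a"
proof -
  have "cinner (unit_vec a) f = (\<Sum>\<^sub>\<infinity>x\<in>{a}. ell2_apply f x)"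
    unfolding cinner.rep_eq unit_vec.rep_eq by (rule infsum_cong_neutral) auto
  then show ?thesis by simp
qed

lemma cinner_sum_left: "cinner (sum f F) g = (\<Sum>i\<in>F. cinner (f i) g)"
proof -
  have "cinner 0 g = 0" by transfer simp
  then show ?thesis by (induction F rule: infinite_finite_induct) (auto simp: cinner_add_left)
qed

lifting_forget ell2.lifting

subsection \<open>Bounded operators\<close>

text \<open>
  Bounded operators on \<open>\<ell>\<^sup>2(X)\<close>. The type \<^typ>\<open>'a \<Rightarrow>\<^sub>L 'b\<close> only knows real-linear maps, so
  complex linearity is imposed separately.
\<close>

typedef 'x bop = "{T :: 'x ell2 \<Rightarrow>\<^sub>L 'x ell2. \<forall>c v. blinfun_apply T (c *\<^sub>C v) = c *\<^sub>C blinfun_apply T v}"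
  morphisms blinfun_of_bop Abs_bop
  by (rule exI[of _ 0]) (auto intro!: ell2_eqI simp: scaleC.rep_eq zero_ell2.rep_eq)

setup_lifting type_definition_bop

lift_definition bop_apply :: "'x bop \<Rightarrow> 'x ell2 \<Rightarrow> 'x ell2" is blinfun_apply .

lemma bop_eqI: "(\<And>v. bop_apply S v = bop_apply T v) \<Longrightarrow> S = T"
  by transfer (rule blinfun_eqI)

lemma exists_nonzero_ell2: "\<exists>f :: 'x ell2. f \<noteq> 0"
proof -
  fix a :: 'x
  have "ell2_apply (unit_vec a) a \<noteq> ell2_apply 0 a"
    by (simp add: unit_vec.rep_eq zero_ell2.rep_eq)
  then show ?thesis by metis
qed

instantiation bop :: (type) real_normed_algebra_1
begin

lift_definition zero_bop :: "'a bop" is 0 by (simp add: scaleC_linear_simps)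
lift_definition one_bop :: "'a bop" is id_blinfun by simp
lift_definition plus_bop :: "'a bop \<Rightarrow> 'a bop \<Rightarrow> 'a bop" is "(+)"
  by (simp add: blinfun.add_left scaleC_linear_simps)
lift_definition uminus_bop :: "'a bop \<Rightarrow> 'a bop" is uminus
  by (simp add: blinfun.minus_left scaleC_linear_simps)
lift_definition minus_bop :: "'a bop \<Rightarrow> 'a bop \<Rightarrow> 'a bop" is "(-)"
  by (simp add: blinfun.diff_left scaleC_linear_simps)
lift_definition scaleR_bop :: "real \<Rightarrow> 'a bop \<Rightarrow> 'a bop" is "(*\<^sub>R)"
  by (simp add: blinfun.scaleR_left scaleC_linear_simps)
lift_definition times_bop :: "'a bop \<Rightarrow> 'a bop \<Rightarrow> 'a bop" is "(o\<^sub>L)"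
  by simp
lift_definition norm_bop :: "'a bop \<Rightarrow> real" is norm .
definition dist_bop :: "'a bop \<Rightarrow> 'a bop \<Rightarrow> real" where "dist_bop S T = norm (S - T)"
definition sgn_bop :: "'a bop \<Rightarrow> 'a bop" where "sgn_bop T = scaleR (inverse (norm T)) T"
definition uniformity_bop :: "('a bop \<times> 'a bop) filter"
  where "uniformity_bop = (INF e\<in>{0<..}. principal {(S, T). dist S T < e})"
definition open_bop :: "'a bop set \<Rightarrow> bool"
  where "open_bop U \<longleftrightarrow> (\<forall>S\<in>U. \<forall>\<^sub>F (S', T) in uniformity. S' = S \<longrightarrow> T \<in> U)"

instance
proof
  fix R S T :: "'a bop" and r s :: real and U :: "'a bop set"
  show "R + S + T = R + (S + T)" by transfer (simp add: add.assoc)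
  show "S + T = T + S" by transfer (simp add: add.commute)
  show "0 + T = T" by transfer simp
  show "- T + T = 0" by transfer simp
  show "S - T = S + - T" by transfer simp
  show "r *\<^sub>R (S + T) = r *\<^sub>R S + r *\<^sub>R T" by transfer (simp add: scaleR_add_right)
  show "(r + s) *\<^sub>R T = r *\<^sub>R T + s *\<^sub>R T" by transfer (simp add: scaleR_add_left)
  show "r *\<^sub>R s *\<^sub>R T = (r * s) *\<^sub>R T" by transfer simp
  show "1 *\<^sub>R T = T" by transfer simp
  show "R * S * T = R * (S * T)" by transfer (rule blinfun_eqI, simp)
  show "(R + S) * T = R * T + S * T" by transfer (rule blinfun_eqI, simp add: blinfun.bilinear_simps)
  show "R * (S + T) = R * S + R * T" by transfer (rule blinfun_eqI, simp add: blinfun.bilinear_simps)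
  show "r *\<^sub>R S * T = r *\<^sub>R (S * T)" by transfer (rule blinfun_eqI, simp add: blinfun.bilinear_simps)
  show "S * r *\<^sub>R T = r *\<^sub>R (S * T)" by transfer (rule blinfun_eqI, simp add: blinfun.bilinear_simps)
  show "1 * T = T" by transfer (rule blinfun_eqI, simp)
  show "T * 1 = T" by transfer (rule blinfun_eqI, simp)
  obtain f :: "'a ell2" where f: "f \<noteq> 0" using exists_nonzero_ell2 by blast
  then show "(0 :: 'a bop) \<noteq> 1"
  proof transfer
    show "(0 :: 'a ell2 \<Rightarrow>\<^sub>L 'a ell2) \<noteq> id_blinfun"
    proof
      assume "(0 :: 'a ell2 \<Rightarrow>\<^sub>L 'a ell2) = id_blinfun"
      from arg_cong[OF this, of "\<lambda>T. blinfun_apply T f"] f show False by simp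
    qed
  qed
  show "norm (1 :: 'a bop) = 1"
  proof transfer
    have "norm f \<le> norm (id_blinfun :: 'a ell2 \<Rightarrow>\<^sub>L 'a ell2) * norm f"
      using norm_blinfun[of id_blinfun f] by simp
    then show "norm (id_blinfun :: 'a ell2 \<Rightarrow>\<^sub>L 'a ell2) = 1"
      using f norm_blinfun_id_le[where 'a = "'a ell2"] by (auto intro: antisym)
  qed
  show "sgn T = scaleR (inverse (norm T)) T" by (rule sgn_bop_def)
  show "dist S T = norm (S - T)" by (rule dist_bop_def)
  show "uniformity = (INF e\<in>{0<..}. principal {(S :: 'a bop, T). dist S T < e})"
    by (rule uniformity_bop_def)
  show "open U \<longleftrightarrow> (\<forall>S\<in>U. \<forall>\<^sub>F (S', T) in uniformity. S' = S \<longrightarrow> T \<in> U)"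
    by (rule open_bop_def)
  show "norm T = 0 \<longleftrightarrow> T = 0" by transfer simp
  show "norm (S + T) \<le> norm S + norm T" by transfer (rule norm_triangle_ineq)
  show "norm (r *\<^sub>R T) = \<bar>r\<bar> * norm T" by transfer simp
  show "norm (S * T) \<le> norm S * norm T" by transfer (rule norm_blinfun_compose)
qed

end

lemma norm_bop_apply: "norm (bop_apply T v) \<le> norm T * norm v"
  by transfer (rule norm_blinfun)

lemma bop_apply_simps [simp]:
  "bop_apply 0 v = 0" "bop_apply 1 v = v" "bop_apply (S + T) v = bop_apply S v + bop_apply T v"
  "bop_apply (- T) v = - bop_apply T v" "bop_apply (S - T) v = bop_apply S v - bop_apply T v"
  "bop_apply (r *\<^sub>R T) v = r *\<^sub>R bop_apply T v" "bop_apply (S * T) v = bop_apply S (bop_apply T v)"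
  by (transfer; simp add: blinfun.bilinear_simps)+

lemma bop_apply_linear:
  "bop_apply T (v + w) = bop_apply T v + bop_apply T w"
  "bop_apply T (c *\<^sub>C v) = c *\<^sub>C bop_apply T v"
  "bop_apply T 0 = 0"
  by (transfer; simp add: blinfun.bilinear_simps)+

lemma bounded_linear_bop_apply: "bounded_linear (bop_apply T)"
  by transfer (rule blinfun.bounded_linear_right)

lemma bop_exists:
  assumes add: "\<And>u v. f (u + v) = f u + f v"
    and scale: "\<And>c v. f (c *\<^sub>C v) = c *\<^sub>C f v"
    and bound: "\<And>v. norm (f v) \<le> K * norm v"
  shows "\<exists>T. \<forall>v. bop_apply T v = f v"
proof -
  have "bounded_linear f"
    by (rule bounded_linear_intro[where K = K])
       (use assms in \<open>auto simp: scaleR_scaleC mult.commute\<close>)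
  then have B: "blinfun_apply (Blinfun f) = f" by (rule bounded_linear_Blinfun_apply)
  have "bop_apply (Abs_bop (Blinfun f)) v = f v" for v
    by (simp add: bop_apply.rep_eq Abs_bop_inverse B scale)
  then show ?thesis by blast
qed

lemma bop_apply_sum: "bop_apply T (sum f F) = (\<Sum>i\<in>F. bop_apply T (f i))"
  by (induction F rule: infinite_finite_induct) (auto simp: bop_apply_linear)

lemma adjoint_exists: "\<exists>S. \<forall>u v. cinner (bop_apply T u) v = cinner u (bop_apply S v)"
proof -
  define c where "c v x = cinner (bop_apply T (unit_vec x)) v" for v x
  have fin: "(\<Sum>x\<in>F. (cmod (c v x))\<^sup>2) \<le> (norm T * norm v)\<^sup>2" if F: "finite F" for F v
  proof -
    define w where "w = (\<Sum>x\<in>F. c v x *\<^sub>C unit_vec x)"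
    define s where "s = (\<Sum>x\<in>F. (cmod (c v x))\<^sup>2)"
    have wa: "ell2_apply w x = (if x \<in> F then c v x else 0)" for x
      unfolding w_def ell2_apply_sum using F
      by (simp add: scaleC.rep_eq unit_vec.rep_eq if_distrib[of "(*) _"] cong: if_cong)
    have "(norm w)\<^sup>2 = (\<Sum>\<^sub>\<infinity>x\<in>F. (cmod (c v x))\<^sup>2)"
      unfolding norm_ell2_square wa by (rule infsum_cong_neutral) auto
    then have nw: "(norm w)\<^sup>2 = s" using F by (simp add: s_def)
    have "cinner (bop_apply T w) v = (\<Sum>x\<in>F. cnj (c v x) * c v x)"
      by (simp add: w_def bop_apply_sum bop_apply_linear cinner_sum_left cinner_scaleC_left c_def)
    also have "\<dots> = of_real s"
      by (simp add: s_def mult.commute flip: complex_norm_square)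
    finally have "s \<le> cmod (cinner (bop_apply T w) v)" by simp
    also have "\<dots> \<le> norm (bop_apply T w) * norm v" by (rule norm_cinner_le)
    also have "\<dots> \<le> (norm T * norm w) * norm v" by (intro mult_right_mono norm_bop_apply) simp
    finally have le: "(norm w)\<^sup>2 \<le> norm w * (norm T * norm v)" by (simp add: nw mult_ac)
    have "norm w \<le> norm T * norm v"
      using le by (cases "norm w = 0") (auto simp: power2_eq_square)
    then have "(norm w)\<^sup>2 \<le> (norm T * norm v)\<^sup>2" by (intro power_mono) auto
    then show ?thesis by (simp add: nw s_def)
  qed
  define f where "f v = Abs_ell2 (c v)" for v
  have f: "ell2_apply (f v) x = c v x" for v x
    unfolding f_def using square_summable_boundedI[OF fin] by (simp add: Abs_ell2_inverse)
  have "\<exists>S. \<forall>v. bop_apply S v = f v"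
  proof (rule bop_exists)
    show "f (u + v) = f u + f v" for u v
      by (rule ell2_eqI) (simp add: f plus_ell2.rep_eq c_def cinner_add_right)
    show "f (z *\<^sub>C v) = z *\<^sub>C f v" for z v
      by (rule ell2_eqI) (simp add: f scaleC.rep_eq c_def cinner_scaleC_right)
    show "norm (f v) \<le> norm T * norm v" for v
      by (rule norm_ell2_boundedI) (use fin in \<open>auto simp: f\<close>)
  qed
  then obtain S where S: "\<And>v. bop_apply S v = f v" by blast
  have "cinner (bop_apply T u) v = cinner u (bop_apply S v)" for u v
  proof -
    define d where "d u = cinner (bop_apply T u) v - cinner u (bop_apply S v)" for u
    define K where "K = norm T * norm v + norm (bop_apply S v)"
    have unit: "d (unit_vec x) = 0" for x
      by (simp add: d_def S cinner_unit_vec f c_def)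
    have d_add: "d (a + b) = d a + d b" for a b
      by (simp add: d_def bop_apply_linear cinner_add_left)
    have d_scale: "d (z *\<^sub>C a) = cnj z * d a" for a z
      by (simp add: d_def bop_apply_linear cinner_scaleC_left algebra_simps)
    have d0: "d 0 = 0" using d_add[of 0 0] by simp
    have d_sum: "d (\<Sum>x\<in>F. g x *\<^sub>C unit_vec x) = 0" for g and F :: "'a set"
      by (induction F rule: infinite_finite_induct) (auto simp: d0 d_add d_scale unit)
    have d_bound: "cmod (d a) \<le> K * norm a" for a
    proof -
      have "cmod (d a) \<le> cmod (cinner (bop_apply T a) v) + cmod (cinner a (bop_apply S v))"
        unfolding d_def by (rule norm_triangle_ineq4)
      also have "\<dots> \<le> norm (bop_apply T a) * norm v + norm a * norm (bop_apply S v)"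
        by (intro add_mono norm_cinner_le)
      also have "\<dots> \<le> (norm T * norm a) * norm v + norm a * norm (bop_apply S v)"
        by (intro add_mono mult_right_mono norm_bop_apply) auto
      finally show ?thesis by (simp add: K_def algebra_simps)
    qed
    have K0: "0 \<le> K" by (simp add: K_def)
    have small: "cmod (d u) \<le> K * e" if "e > 0" for e
    proof -
      have "((\<lambda>x. (cmod (ell2_apply u x))\<^sup>2) has_sum (norm u)\<^sup>2) UNIV"
        using square_summable_ell2[of u] unfolding norm_ell2_square square_summable_def
        by (rule has_sum_infsum)
      from has_sum_finite_approximation[OF this, of "e\<^sup>2"] \<open>e > 0\<close>
      obtain F where F: "finite F" "dist (\<Sum>x\<in>F. (cmod (ell2_apply u x))\<^sup>2) ((norm u)\<^sup>2) \<le> e\<^sup>2"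
        by auto
      define p where "p = (\<Sum>x\<in>F. ell2_apply u x *\<^sub>C unit_vec x)"
      have pa: "ell2_apply p x = (if x \<in> F then ell2_apply u x else 0)" for x
        unfolding p_def ell2_apply_sum using F(1)
        by (simp add: scaleC.rep_eq unit_vec.rep_eq if_distrib[of "(*) _"] cong: if_cong)
      have "norm (u - p) \<le> e"
      proof (rule norm_ell2_boundedI)
        fix H :: "'a set" assume H: "finite H"
        have "(\<Sum>x\<in>H. (cmod (ell2_apply (u - p) x))\<^sup>2) = (\<Sum>x\<in>H - F. (cmod (ell2_apply u x))\<^sup>2)"
          by (rule sum.mono_neutral_cong_right) (use H in \<open>auto simp: minus_ell2.rep_eq pa\<close>)
        also have "\<dots> = (\<Sum>x\<in>H \<union> F. (cmod (ell2_apply u x))\<^sup>2) - (\<Sum>x\<in>F. (cmod (ell2_apply u x))\<^sup>2)"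
          using sum.subset_diff[of F "H \<union> F" "\<lambda>x. (cmod (ell2_apply u x))\<^sup>2"] F(1) H
          by (simp add: Un_Diff)
        also have "\<dots> \<le> (norm u)\<^sup>2 - (\<Sum>x\<in>F. (cmod (ell2_apply u x))\<^sup>2)"
          using finite_sum_le_norm_ell2[of "H \<union> F" u] F(1) H by simp
        also have "\<dots> \<le> e\<^sup>2" using F(2) by (simp add: dist_real_def)
        finally show "(\<Sum>x\<in>H. (cmod (ell2_apply (u - p) x))\<^sup>2) \<le> e\<^sup>2" .
      qed (use \<open>e > 0\<close> in simp)
      moreover have "d u = d (u - p)"
        using d_add[of "u - p" p] d_sum[of "ell2_apply u" F] by (simp add: p_def)
      ultimately show ?thesis
        using d_bound[of "u - p"] mult_left_mono[of "norm (u - p)" e K] K0 by simp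
    qed
    have "cmod (d u) \<le> 0"
    proof (rule field_le_epsilon)
      fix e :: real assume e: "e > 0"
      have "cmod (d u) \<le> K * (e / (K + 1))" using small[of "e / (K + 1)"] e K0 by simp
      also have "\<dots> \<le> e" using e K0 by (simp add: field_simps)
      finally show "cmod (d u) \<le> 0 + e" by simp
    qed
    then show ?thesis by (simp add: d_def)
  qed
  then show ?thesis by blast
qed

text \<open>
  Just enough structure for projections, positive elements and traces; multiplication by non-real
  scalars plays no role in these notions, so it is not part of the class.
\<close>

class star_algebra = real_algebra +
  fixes star :: "'a \<Rightarrow> 'a"
  assumes star_star [simp]: "star (star x) = x"
    and star_add: "star (x + y) = star x + star y"
    and star_mult: "star (x * y) = star y * star x"
    and star_scaleR: "star (r *\<^sub>R x) = r *\<^sub>R star x"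

instantiation bop :: (type) star_algebra
begin

definition star_bop :: "'a bop \<Rightarrow> 'a bop" where
  "star_bop T = (THE S. \<forall>u v. cinner (bop_apply T u) v = cinner u (bop_apply S v))"

lemma cinner_star_bop: "cinner (bop_apply T u) v = cinner u (bop_apply (star T) v)" for T :: "'a bop"
proof -
  have "\<exists>!S. \<forall>u v. cinner (bop_apply T u) v = cinner u (bop_apply S v)"
  proof (rule ex_ex1I)
    show "\<exists>S. \<forall>u v. cinner (bop_apply T u) v = cinner u (bop_apply S v)" by (rule adjoint_exists)
    show "S = S'" if "\<forall>u v. cinner (bop_apply T u) v = cinner u (bop_apply S v)"
      "\<forall>u v. cinner (bop_apply T u) v = cinner u (bop_apply S' v)" for S S'
      by (intro bop_eqI cinner_eqI) (metis that)
  qed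
  from theI'[OF this] show ?thesis unfolding star_bop_def by blast
qed

lemma star_bop_eqI:
  fixes S T :: "'a bop"
  assumes "\<And>u v. cinner (bop_apply T u) v = cinner u (bop_apply S v)"
  shows "star T = S"
  by (intro bop_eqI cinner_eqI) (metis assms cinner_star_bop)

instance
proof
  fix S T :: "'a bop" and r :: real
  show "star (star T) = T"
    by (rule star_bop_eqI) (metis cinner_star_bop cinner_commute)
  show "star (S + T) = star S + star T"
    by (rule star_bop_eqI) (simp add: cinner_add_left cinner_add_right cinner_star_bop)
  show "star (S * T) = star T * star S"
    by (rule star_bop_eqI) (simp add: cinner_star_bop)
  show "star (r *\<^sub>R T) = r *\<^sub>R star T"
    by (rule star_bop_eqI)
       (simp add: scaleR_scaleC cinner_scaleC_left cinner_scaleC_right cinner_star_bop)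
qed

end

instantiation "fun" :: (type, real_algebra) real_algebra
begin

definition "r *\<^sub>R f = (\<lambda>x. r *\<^sub>R f x)"

instance
  by standard (auto simp: fun_eq_iff scaleR_fun_def algebra_simps)

end

lemma scaleR_fun_apply [simp]: "(r *\<^sub>R f) x = r *\<^sub>R f x"
  by (simp add: scaleR_fun_def)

instantiation "fun" :: (type, star_algebra) star_algebra
begin

definition "star f = (\<lambda>x. star (f x))"

instance
  by standard (auto simp: fun_eq_iff star_fun_def star_add star_mult star_scaleR)

end

lemma star_fun_apply [simp]: "star f x = star (f x)"
  by (simp add: star_fun_def)

definition compact_op :: "'x bop \<Rightarrow> bool" where
  "compact_op T \<longleftrightarrow> compact (closure (bop_apply T ` cball 0 1))"

subsection \<open>Projections and traces\<close>

text \<open>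
  Here \<open>A\<close> ranges over \<open>C\<^sup>*\<close>-algebras realised as self-adjoint subalgebras of the ambient type,
  which need not be normed itself. Every positive element of such an \<open>A\<close> has the form \<open>x\<^sup>* x\<close> with \<open>x \<in> A\<close>, and \<open>p \<le> q\<close> means
  \<open>q - p \<in> positive_cone A\<close>.
\<close>

definition positive_cone :: "'a::star_algebra set \<Rightarrow> 'a set" where
  "positive_cone A = {star x * x | x. x \<in> A}"

definition is_projection :: "'a::star_algebra \<Rightarrow> bool" where
  "is_projection p \<longleftrightarrow> star p = p \<and> p * p = p"

definition mvn_equivalent :: "'a::star_algebra set \<Rightarrow> 'a \<Rightarrow> 'a \<Rightarrow> bool" where
  "mvn_equivalent A p q \<longleftrightarrow> (\<exists>v\<in>A. star v * v = p \<and> v * star v = q)"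

definition properly_infinite :: "'a::star_algebra set \<Rightarrow> 'a \<Rightarrow> bool" where
  "properly_infinite A p \<longleftrightarrow>
     p \<in> A \<and> is_projection p \<and> p \<noteq> 0 \<and>
     (\<exists>p1\<in>A. \<exists>p2\<in>A.
        is_projection p1 \<and> is_projection p2 \<and> p1 * p2 = 0 \<and>
        p - p1 \<in> positive_cone A \<and> p - p2 \<in> positive_cone A \<and>
        mvn_equivalent A p1 p \<and> mvn_equivalent A p2 p)"

text \<open>
  Only the values of \<open>\<tau>\<close> on \<open>positive_cone A\<close> matter. In \<^typ>\<open>ennreal\<close>, \<open>0 * \<infinity> = 0\<close>, so \<open>\<tau> 0 = 0\<close>.
\<close>

definition is_trace :: "'a::star_algebra set \<Rightarrow> ('a \<Rightarrow> ennreal) \<Rightarrow> bool" where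
  "is_trace A \<tau> \<longleftrightarrow>
     (\<forall>x\<in>positive_cone A. \<forall>y\<in>positive_cone A. \<tau> (x + y) = \<tau> x + \<tau> y) \<and>
     (\<forall>x\<in>positive_cone A. \<forall>r\<ge>0. \<tau> (r *\<^sub>R x) = ennreal r * \<tau> x) \<and>
     (\<forall>x\<in>A. \<tau> (star x * x) = \<tau> (x * star x))"

subsection \<open>Reduced crossed products\<close>

text \<open>\<open>\<ell>\<^sup>2(G \<times> X)\<close> is viewed as \<open>\<ell>\<^sup>2(G, \<ell>\<^sup>2(X))\<close>; \<open>slice \<xi> s\<close> is the value of \<open>\<xi>\<close> at \<open>s \<in> G\<close>.\<close>

definition slice :: "('g \<times> 'x) ell2 \<Rightarrow> 'g \<Rightarrow> 'x ell2" where
  "slice \<xi> s = Abs_ell2 (\<lambda>x. ell2_apply \<xi> (s, x))"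

lemma slice_apply: "ell2_apply (slice \<xi> s) x = ell2_apply \<xi> (s, x)"
  for \<xi> :: "('g \<times> 'x) ell2"
proof -
  have "square_summable (\<lambda>x. ell2_apply \<xi> (s, x))"
  proof (rule square_summable_boundedI)
    fix F :: "'x set" assume "finite F"
    then show "(\<Sum>x\<in>F. (cmod (ell2_apply \<xi> (s, x)))\<^sup>2) \<le> (norm \<xi>)\<^sup>2"
      using finite_sum_le_norm_ell2[of "Pair s ` F" \<xi>] by (simp add: sum.reindex inj_on_def)
  qed
  then show ?thesis by (simp add: slice_def Abs_ell2_inverse)
qed

lemma ell2_eq_sliceI: "(\<And>s. slice \<xi> s = slice \<eta> s) \<Longrightarrow> \<xi> = \<eta>"
  by (rule ell2_eqI) (metis slice_apply surj_pair)

lemma slice_linear: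
  "slice (\<xi> + \<eta>) s = slice \<xi> s + slice \<eta> s"
  "slice (c *\<^sub>C \<xi>) s = c *\<^sub>C slice \<xi> s"
  by (rule ell2_eqI, simp add: slice_apply plus_ell2.rep_eq scaleC.rep_eq)+

lemma sum_norm_slice_le:
  assumes S: "finite S"
  shows "(\<Sum>s\<in>S. (norm (slice \<xi> s))\<^sup>2) \<le> (norm \<xi>)\<^sup>2"
proof -
  have "((\<lambda>x. (cmod (ell2_apply \<xi> (s, x)))\<^sup>2) has_sum (norm (slice \<xi> s))\<^sup>2) UNIV" for s
    using square_summable_ell2[of "slice \<xi> s"]
    unfolding norm_ell2_square square_summable_def slice_apply by (rule has_sum_infsum)
  then have "((\<lambda>x. \<Sum>s\<in>S. (cmod (ell2_apply \<xi> (s, x)))\<^sup>2) has_sum (\<Sum>s\<in>S. (norm (slice \<xi> s))\<^sup>2)) UNIV"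
    by (induction S rule: infinite_finite_induct) (auto intro: has_sum_add)
  moreover have "(\<Sum>x\<in>F. \<Sum>s\<in>S. (cmod (ell2_apply \<xi> (s, x)))\<^sup>2) \<le> (norm \<xi>)\<^sup>2" if "finite F" for F
    using finite_sum_le_norm_ell2[of "S \<times> F" \<xi>] S that
    by (subst sum.swap) (simp add: sum.cartesian_product)
  ultimately show ?thesis
    by (metis (no_types, lifting) has_sum_le_finite_sums)
qed

text \<open>
  The operator \<open>(T \<xi>)(s) = a(s) \<xi>(s)\<close>; it exists whenever \<open>a\<close> is bounded, see
  \<open>slice_block_diag\<close> below.
\<close>

definition block_diag :: "('g \<Rightarrow> 'x bop) \<Rightarrow> ('g \<times> 'x) bop" where
  "block_diag a = (THE T. \<forall>\<xi> s. slice (bop_apply T \<xi>) s = bop_apply (a s) (slice \<xi> s))"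

lemma block_diag_props:
  fixes a :: "'g \<Rightarrow> 'x bop"
  assumes K: "\<And>s. norm (a s) \<le> K"
  shows "slice (bop_apply (block_diag a) \<xi>) s = bop_apply (a s) (slice \<xi> s)"
    and "norm (block_diag a) \<le> K"
proof -
  have K0: "0 \<le> K" using order_trans[OF norm_ge_zero K] by blast
  define h where "h \<xi> = (\<lambda>(s, x). ell2_apply (bop_apply (a s) (slice \<xi> s)) x)" for \<xi>
  have fin: "(\<Sum>z\<in>F. (cmod (h \<xi> z))\<^sup>2) \<le> (K * norm \<xi>)\<^sup>2" if F: "finite F" for F \<xi>
  proof -
    have "(\<Sum>z\<in>F. (cmod (h \<xi> z))\<^sup>2) \<le> (\<Sum>z\<in>fst ` F \<times> snd ` F. (cmod (h \<xi> z))\<^sup>2)"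
      by (rule sum_mono2) (use F in \<open>auto simp: rev_image_eqI\<close>)
    also have "\<dots> = (\<Sum>s\<in>fst ` F. \<Sum>x\<in>snd ` F. (cmod (ell2_apply (bop_apply (a s) (slice \<xi> s)) x))\<^sup>2)"
      by (simp add: h_def sum.cartesian_product case_prod_unfold)
    also have "\<dots> \<le> (\<Sum>s\<in>fst ` F. (norm (bop_apply (a s) (slice \<xi> s)))\<^sup>2)"
      by (intro sum_mono finite_sum_le_norm_ell2) (use F in auto)
    also have "\<dots> \<le> (\<Sum>s\<in>fst ` F. K\<^sup>2 * (norm (slice \<xi> s))\<^sup>2)"
    proof (rule sum_mono)
      fix s
      have "norm (bop_apply (a s) (slice \<xi> s)) \<le> K * norm (slice \<xi> s)"
        by (rule order_trans[OF norm_bop_apply]) (intro mult_right_mono K norm_ge_zero)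
      then show "(norm (bop_apply (a s) (slice \<xi> s)))\<^sup>2 \<le> K\<^sup>2 * (norm (slice \<xi> s))\<^sup>2"
        unfolding power_mult_distrib[symmetric] by (rule power_mono) simp
    qed
    also have "\<dots> \<le> K\<^sup>2 * (norm \<xi>)\<^sup>2"
      unfolding sum_distrib_left[symmetric]
      by (intro mult_left_mono sum_norm_slice_le) (use F in auto)
    finally show ?thesis by (simp add: power_mult_distrib)
  qed
  define f where "f \<xi> = Abs_ell2 (h \<xi>)" for \<xi>
  have f: "ell2_apply (f \<xi>) = h \<xi>" for \<xi>
    unfolding f_def using square_summable_boundedI[OF fin] by (simp add: Abs_ell2_inverse)
  have sf: "slice (f \<xi>) s = bop_apply (a s) (slice \<xi> s)" for \<xi> s
    by (rule ell2_eqI) (simp add: slice_apply f h_def)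
  have fb: "norm (f \<xi>) \<le> K * norm \<xi>" for \<xi>
    by (rule norm_ell2_boundedI) (use fin K0 in \<open>auto simp: f\<close>)
  have "\<exists>T. \<forall>\<xi>. bop_apply T \<xi> = f \<xi>"
  proof (rule bop_exists)
    show "f (\<xi> + \<eta>) = f \<xi> + f \<eta>" for \<xi> \<eta>
      by (rule ell2_eq_sliceI) (simp add: sf slice_linear bop_apply_linear)
    show "f (c *\<^sub>C \<xi>) = c *\<^sub>C f \<xi>" for c \<xi>
      by (rule ell2_eq_sliceI) (simp add: sf slice_linear bop_apply_linear)
    show "norm (f \<xi>) \<le> K * norm \<xi>" for \<xi>
      by (rule fb)
  qed
  then obtain T where T: "\<And>\<xi>. bop_apply T \<xi> = f \<xi>" by blast
  have "\<exists>!T. \<forall>\<xi> s. slice (bop_apply T \<xi>) s = bop_apply (a s) (slice \<xi> s)"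
  proof (rule ex1I[of _ T])
    show "\<forall>\<xi> s. slice (bop_apply T \<xi>) s = bop_apply (a s) (slice \<xi> s)" by (simp add: T sf)
    show "S = T" if "\<forall>\<xi> s. slice (bop_apply S \<xi>) s = bop_apply (a s) (slice \<xi> s)" for S
      by (intro bop_eqI ell2_eq_sliceI) (simp add: that T sf)
  qed
  from theI'[OF this]
  have D: "slice (bop_apply (block_diag a) \<xi>) s = bop_apply (a s) (slice \<xi> s)" for \<xi> s
    unfolding block_diag_def by blast
  then show "slice (bop_apply (block_diag a) \<xi>) s = bop_apply (a s) (slice \<xi> s)" .
  have "bop_apply (block_diag a) \<xi> = f \<xi>" for \<xi>
    by (rule ell2_eq_sliceI) (simp add: D sf)
  then have "norm (bop_apply (block_diag a) \<xi>) \<le> K * norm \<xi>" for \<xi>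
    by (simp add: fb)
  then show "norm (block_diag a) \<le> K"
    by (simp add: norm_bop.rep_eq bop_apply.rep_eq norm_blinfun_bound K0)
qed

lemma slice_block_diag:
  assumes "bounded (range a)"
  shows "slice (bop_apply (block_diag a) \<xi>) s = bop_apply (a s) (slice \<xi> s)"
  using assms block_diag_props(1)[of a] by (auto simp: bounded_iff)

lemma inj_on_block_diag: "inj_on block_diag {a :: 'g \<Rightarrow> 'x bop. bounded (range a)}"
proof (rule inj_onI, rule ext, rule bop_eqI)
  fix a b :: "'g \<Rightarrow> 'x bop" and s :: 'g and v :: "'x ell2"
  assume ab: "a \<in> {a. bounded (range a)}" "b \<in> {a. bounded (range a)}" "block_diag a = block_diag b"
  define h where "h = (\<lambda>(t :: 'g, x :: 'x). if t = s then ell2_apply v x else 0)"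
  have "square_summable h"
  proof (rule square_summable_boundedI)
    fix F :: "('g \<times> 'x) set" assume F: "finite F"
    have "(\<Sum>z\<in>F. (cmod (h z))\<^sup>2) = (\<Sum>z\<in>F \<inter> {s} \<times> UNIV. (cmod (h z))\<^sup>2)"
      by (rule sum.mono_neutral_right) (use F in \<open>auto simp: h_def split: if_splits\<close>)
    also have "\<dots> = (\<Sum>x\<in>snd ` (F \<inter> {s} \<times> UNIV). (cmod (ell2_apply v x))\<^sup>2)"
      by (subst sum.reindex) (auto simp: inj_on_def h_def intro!: sum.cong)
    also have "\<dots> \<le> (norm v)\<^sup>2" by (rule finite_sum_le_norm_ell2) (use F in auto)
    finally show "(\<Sum>z\<in>F. (cmod (h z))\<^sup>2) \<le> (norm v)\<^sup>2" .
  qed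
  then have "slice (Abs_ell2 h) s = v"
    by (intro ell2_eqI) (simp add: slice_apply Abs_ell2_inverse h_def)
  then show "bop_apply (a s) v = bop_apply (b s) v"
    using slice_block_diag[of a "Abs_ell2 h" s] slice_block_diag[of b "Abs_ell2 h" s] ab by simp
qed

text \<open>
  Groups are written additively, following the class \<^class>\<open>group_add\<close>, which does not assume
  commutativity: \<open>- t + s\<close> is \<open>t\<^sup>-\<^sup>1 s\<close>. Thus \<open>(\<lambda>\<^sub>t \<xi>)(s) = \<xi>(t\<^sup>-\<^sup>1 s)\<close>.
\<close>

definition shift :: "'g::group_add \<Rightarrow> ('g \<times> 'x) bop" where
  "shift t = (THE T. \<forall>\<xi> s x. ell2_apply (bop_apply T \<xi>) (s, x) = ell2_apply \<xi> (- t + s, x))"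

lemma shift_apply: "ell2_apply (bop_apply (shift t) \<xi>) (s, x) = ell2_apply \<xi> (- t + s, x)"
  for t :: "'g::group_add" and \<xi> :: "('g \<times> 'x) ell2"
proof -
  define h where "h \<xi> = (\<lambda>(s, x). ell2_apply \<xi> (- t + s, x))" for \<xi> :: "('g \<times> 'x) ell2"
  have fin: "(\<Sum>z\<in>F. (cmod (h \<xi> z))\<^sup>2) \<le> (1 * norm \<xi>)\<^sup>2" if F: "finite F" for F \<xi>
  proof -
    have "(\<Sum>z\<in>F. (cmod (h \<xi> z))\<^sup>2) = (\<Sum>z\<in>(\<lambda>(s, x). (- t + s, x)) ` F. (cmod (ell2_apply \<xi> z))\<^sup>2)"
      by (subst sum.reindex) (auto simp: inj_on_def h_def case_prod_unfold)
    also have "\<dots> \<le> (norm \<xi>)\<^sup>2" by (rule finite_sum_le_norm_ell2) (use F in auto)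
    finally show ?thesis by simp
  qed
  define f where "f \<xi> = Abs_ell2 (h \<xi>)" for \<xi>
  have f: "ell2_apply (f \<xi>) = h \<xi>" for \<xi>
    unfolding f_def using square_summable_boundedI[OF fin] by (simp add: Abs_ell2_inverse)
  have "\<exists>T. \<forall>\<xi>. bop_apply T \<xi> = f \<xi>"
  proof (rule bop_exists)
    show "f (\<xi> + \<eta>) = f \<xi> + f \<eta>" for \<xi> \<eta>
      by (rule ell2_eqI) (simp add: f h_def plus_ell2.rep_eq case_prod_unfold)
    show "f (c *\<^sub>C \<xi>) = c *\<^sub>C f \<xi>" for c \<xi>
      by (rule ell2_eqI) (simp add: f h_def scaleC.rep_eq case_prod_unfold)
    show "norm (f \<xi>) \<le> 1 * norm \<xi>" for \<xi>
      by (rule norm_ell2_boundedI) (use fin in \<open>auto simp: f\<close>)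
  qed
  then obtain T where T: "\<And>\<xi>. bop_apply T \<xi> = f \<xi>" by blast
  have "\<exists>!T. \<forall>(\<xi> :: ('g \<times> 'x) ell2) s x. ell2_apply (bop_apply T \<xi>) (s, x) = ell2_apply \<xi> (- t + s, x)"
  proof (rule ex1I[of _ T])
    show "\<forall>\<xi> s x. ell2_apply (bop_apply T \<xi>) (s, x) = ell2_apply \<xi> (- t + s, x)"
      by (simp add: T f h_def)
    show "S = T" if "\<forall>\<xi> s x. ell2_apply (bop_apply S \<xi>) (s, x) = ell2_apply \<xi> (- t + s, x)" for S
      by (intro bop_eqI ell2_eqI) (auto simp: that T f h_def)
  qed
  from theI'[OF this] show ?thesis unfolding shift_def by blast
qed

lemma slice_shift: "slice (bop_apply (shift t) \<xi>) s = slice \<xi> (- t + s)"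
  by (rule ell2_eqI) (simp add: slice_apply shift_apply)

text \<open>
  For an action \<open>\<alpha>\<close> of \<open>G\<close> on a \<open>C\<^sup>*\<close>-algebra \<open>A\<close> with faithful representation \<open>\<rho>\<close> on \<open>\<ell>\<^sup>2(X)\<close>, the
  regular representation on \<open>\<ell>\<^sup>2(G, \<ell>\<^sup>2(X))\<close> is \<open>(\<pi>(a) \<xi>)(s) = \<rho>(\<alpha>\<^sub>s\<^sup>-\<^sup>1(a)) \<xi>(s)\<close> together with
  \<open>t \<mapsto> \<lambda>\<^sub>t\<close>. The reduced crossed product is the norm closure of the image of the finitely supported
  functions \<open>G \<rightarrow> A\<close>; up to isomorphism it does not depend on \<open>\<rho>\<close>.
\<close>

definition regular_rep ::
    "('g::group_add \<Rightarrow> 'a \<Rightarrow> 'a) \<Rightarrow> ('a \<Rightarrow> 'x bop) \<Rightarrow> 'a \<Rightarrow> ('g \<times> 'x) bop" where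
  "regular_rep \<alpha> \<rho> a = block_diag (\<lambda>s. \<rho> (\<alpha> (- s) a))"

definition reduced_crossed_product ::
    "'a set \<Rightarrow> ('g::group_add \<Rightarrow> 'a \<Rightarrow> 'a) \<Rightarrow> ('a \<Rightarrow> 'x bop) \<Rightarrow> ('g \<times> 'x) bop set" where
  "reduced_crossed_product A \<alpha> \<rho> =
     closure {\<Sum>t\<in>F. regular_rep \<alpha> \<rho> (a t) * shift t | F a. finite F \<and> a ` F \<subseteq> A}"

lemma shift_regular_rep:
  assumes action: "\<And>s t a. \<alpha> s (\<alpha> t a) = \<alpha> (s + t) a"
    and bounded: "bounded (range (\<lambda>s. \<rho> (\<alpha> s a)))"
  shows "shift t * regular_rep \<alpha> \<rho> a = regular_rep \<alpha> \<rho> (\<alpha> t a) * shift t"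
proof (intro bop_eqI ell2_eq_sliceI)
  fix \<xi> s
  have b: "bounded (range (\<lambda>s. \<rho> (\<alpha> (- s) a)))" "bounded (range (\<lambda>s. \<rho> (\<alpha> (- s) (\<alpha> t a))))"
    by (rule bounded_subset[OF bounded], force simp: action)+
  show "slice (bop_apply (shift t * regular_rep \<alpha> \<rho> a) \<xi>) s
      = slice (bop_apply (regular_rep \<alpha> \<rho> (\<alpha> t a) * shift t) \<xi>) s"
    using b by (simp add: regular_rep_def slice_shift slice_block_diag action minus_add)
qed

subsection \<open>The Roe algebra\<close>

text \<open>
  \<open>K\<close> is realised as the compact operators on \<open>\<ell>\<^sup>2(\<nat>)\<close>. The algebra operations on
  \<open>\<ell>\<^sup>\<infinity>(G, K)\<close> are the pointwise ones, and \<open>block_diag\<close> is its faithful representation on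
  \<open>\<ell>\<^sup>2(G \<times> \<nat>)\<close>, see \<open>inj_on_block_diag\<close>.
\<close>

definition linf_compact :: "('g \<Rightarrow> nat bop) set" where
  "linf_compact = {f. (\<forall>s. compact_op (f s)) \<and> bounded (range f)}"

definition left_translate :: "'g::group_add \<Rightarrow> ('g \<Rightarrow> 'a) \<Rightarrow> 'g \<Rightarrow> 'a" where
  "left_translate t f = (\<lambda>s. f (- t + s))"

text \<open>The canonical inclusion of \<open>\<ell>\<^sup>\<infinity>(G, K)\<close> into its crossed product.\<close>

definition roe_embed :: "('g::group_add \<Rightarrow> nat bop) \<Rightarrow> ('g \<times> 'g \<times> nat) bop" where
  "roe_embed = regular_rep left_translate block_diag"

definition roe_algebra :: "('g::group_add \<times> 'g \<times> nat) bop set" where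
  "roe_algebra = reduced_crossed_product linf_compact left_translate block_diag"

lemma left_translate_add: "left_translate s (left_translate t f) = left_translate (s + t) f"
  by (simp only: left_translate_def minus_add add.assoc)

lemma slice_roe_embed:
  assumes "f \<in> linf_compact"
  shows "slice (slice (bop_apply (roe_embed f) \<xi>) s) r = bop_apply (f (s + r)) (slice (slice \<xi> s) r)"
proof -
  obtain K where K: "\<And>s. norm (f s) \<le> K"
    using assms unfolding linf_compact_def bounded_iff by auto
  have b: "bounded (range (left_translate t f))" for t
    using K by (auto simp: bounded_iff left_translate_def)
  have "norm (block_diag (left_translate t f)) \<le> K" for t
    by (rule block_diag_props(2)) (simp add: left_translate_def K)
  then have "bounded (range (\<lambda>s. block_diag (left_translate (- s) f)))"
    by (auto simp: bounded_iff)
  then show ?thesis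
    by (simp add: roe_embed_def regular_rep_def slice_block_diag b) (simp add: left_translate_def)
qed

subsection \<open>Local finiteness\<close>

definition is_subgroup :: "'g::group_add set \<Rightarrow> bool" where
  "is_subgroup H \<longleftrightarrow> 0 \<in> H \<and> (\<forall>s\<in>H. \<forall>t\<in>H. s + t \<in> H) \<and> (\<forall>s\<in>H. - s \<in> H)"

definition locally_finite_group :: "'g::group_add itself \<Rightarrow> bool" where
  "locally_finite_group _ \<longleftrightarrow> (\<forall>S :: 'g set. finite S \<longrightarrow> finite (is_subgroup hull S))"

end

theory Submission
  imports Defs
begin

text \<open>
  An infinite finitely generated subgroup contains, by Koenig's lemma, distinct elements \<open>x\<^sub>0, x\<^sub>1, \<dots>\<close>
  all of whose steps \<open>x\<^sub>n\<^sub>+\<^sub>1 x\<^sub>n\<^sup>-\<^sup>1\<close> lie in a finite set \<open>S\<close>. Let \<open>p\<close> have rank \<open>c\<^sup>n\<close> at \<open>x\<^sub>n\<close> and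
  rank \<open>0\<close> elsewhere, where \<open>c = |S| + 2\<close>. Moving the range of \<open>p(x\<^sub>n)\<close> into the first or the second block of
  \<open>c\<^sup>n\<close> basis vectors at \<open>x\<^sub>n\<^sub>+\<^sub>1\<close> uses only translations by \<open>S\<close>, so the Roe algebra contains two orthogonal
  copies of \<open>p\<close> below \<open>p\<close>; hence \<open>2 \<tau>(p) \<le> \<tau>(p)\<close> for each trace on it.

  A trace on \<open>\<ell>\<^sup>\<infinity>(G, K)\<close> is additive on rank functions. The rank function \<open>f\<close> of \<open>p\<close> satisfies
  \<open>c f(y) \<le> (\<Sum>t\<in>S. f(t y))\<close>, so \<open>M = (SUP t. \<tau>(t.p))\<close> satisfies \<open>c M \<le> |S| M\<close>; as \<open>c > |S|\<close>, \<open>M\<close> is \<open>0\<close> or \<open>\<infinity>\<close>.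
\<close>

section \<open>Injective rays with finitely many different steps\<close>

text \<open>Keeping only the edges that raise the distance from \<open>r\<close> by one does not
  change what is reachable from \<open>r\<close>. A ray along such edges cannot repeat a vertex,
  since the distance grows strictly.\<close>

lemma konig_ray:
  fixes E :: "('a \<times> 'a) set"
  assumes fin: "\<And>y. finite (E `` {y})" and inf: "infinite (E\<^sup>* `` {r})"
  shows "\<exists>x :: nat \<Rightarrow> 'a. inj x \<and> (\<forall>n. (x n, x (Suc n)) \<in> E)"
proof -
  define d where "d y = (LEAST n. (r, y) \<in> E ^^ n)" for y
  define P where "P = {(y, z) \<in> E. d z = Suc (d y)}"
  \<comment> \<open>On a path of minimal length \<open>Suc n\<close>, the vertex before the last
    edge has distance exactly \<open>n\<close>, so the last edge lies in \<open>P\<close>.\<close>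
  have "y \<in> P\<^sup>* `` {r}" if "(r, y) \<in> E ^^ n" "d y = n" for n y
    using that
  proof (induction n arbitrary: y)
    case (Suc n)
    then obtain u where u: "(r, u) \<in> E ^^ n" "(u, y) \<in> E" by auto
    have "(r, u) \<in> E ^^ d u" unfolding d_def by (rule LeastI) (rule u(1))
    then have "(r, y) \<in> E ^^ Suc (d u)" using u(2) by auto
    then have "d y \<le> Suc (d u)" unfolding d_def[of y] by (rule Least_le)
    moreover have "d u \<le> n" unfolding d_def by (rule Least_le) (rule u(1))
    ultimately have "d u = n" using Suc.prems(2) by simp
    then show ?case using Suc.IH[OF u(1)] u(2) Suc.prems(2)
      by (auto simp: P_def intro: rtrancl_into_rtrancl)
  qed auto
  moreover have "(r, y) \<in> E ^^ d y" if "(r, y) \<in> E ^^ n" for n y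
    unfolding d_def using that by (rule LeastI)
  ultimately have "E\<^sup>* `` {r} \<subseteq> P\<^sup>* `` {r}"
    by (auto dest!: rtrancl_imp_relpow)
  then have "infinite (P\<^sup>* `` {r})" using inf finite_subset by blast
  \<comment> \<open>Every \<open>P\<close>-descendant of \<open>y\<close> other than
    \<open>y\<close> itself descends from one of finitely many successors, so one successor has
    infinitely many descendants.\<close>
  moreover have "\<exists>z. infinite (P\<^sup>* `` {z}) \<and> (y, z) \<in> P" if "infinite (P\<^sup>* `` {y})" for y
  proof (rule ccontr)
    assume contra: "\<nexists>z. infinite (P\<^sup>* `` {z}) \<and> (y, z) \<in> P"
    have "finite (P `` {y})" by (rule finite_subset[OF _ fin[of y]]) (auto simp: P_def)
    then have "finite (insert y (\<Union>z\<in>P `` {y}. P\<^sup>* `` {z}))" using contra by auto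
    moreover have "P\<^sup>* `` {y} \<subseteq> insert y (\<Union>z\<in>P `` {y}. P\<^sup>* `` {z})"
      by (auto elim: converse_rtranclE)
    ultimately show False using that finite_subset by blast
  qed
  ultimately obtain x where x: "\<And>n. infinite (P\<^sup>* `` {x n})" "\<And>n. (x n, x (Suc n)) \<in> P"
    using dependent_nat_choice[of "\<lambda>_ y. infinite (P\<^sup>* `` {y})" "\<lambda>_ y z. (y, z) \<in> P"] by metis
  have "d (x n) = d (x 0) + n" for n
    by (induction n) (use x(2) in \<open>auto simp: P_def\<close>)
  then have "inj x" by (metis add_left_cancel injI)
  with x(2) show ?thesis by (auto simp: P_def)
qed

text \<open>The points reachable from \<open>0\<close> by adding elements of a finite symmetric
  generating set on the left form a subgroup. It contains the generated subgroup, so it is infinite,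
  and each point has finitely many outgoing edges.\<close>

lemma exists_injective_ray:
  assumes "\<not> locally_finite_group TYPE('g::group_add)"
  shows "\<exists>(S :: 'g set) x :: nat \<Rightarrow> 'g. finite S \<and> inj x \<and> (\<forall>n. x (Suc n) - x n \<in> S)"
proof -
  obtain S0 :: "'g set" where S0: "finite S0" "infinite (is_subgroup hull S0)"
    using assms unfolding locally_finite_group_def by blast
  define S where "S = S0 \<union> uminus ` S0"
  define E where "E = {(y, t + y) | t y. t \<in> S}"
  define U where "U = E\<^sup>* `` {0}"
  have S: "finite S" "\<And>t. t \<in> S \<Longrightarrow> - t \<in> S" using S0(1) by (auto simp: S_def)
  have E: "E `` {y} = (\<lambda>t. t + y) ` S" for y by (auto simp: E_def)
  have step: "t + y \<in> U" if "t \<in> S" "y \<in> U" for t y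
    using that unfolding U_def E_def by (auto intro: rtrancl_into_rtrancl)
  have zero: "0 \<in> U" by (simp add: U_def)
  \<comment> \<open>Left addition commutes with right translation, so a walk from \<open>0\<close>
    to \<open>y\<close> becomes a walk from \<open>z\<close> to \<open>y + z\<close>.\<close>
  have add: "y + z \<in> U" if "y \<in> U" "z \<in> U" for y z
  proof -
    have "(0, y) \<in> E\<^sup>*" using that(1) by (simp add: U_def)
    then show ?thesis
      by induction (use that(2) step in \<open>auto simp: E_def add.assoc\<close>)
  qed
  have SU: "t \<in> U" if "t \<in> S" for t using step[OF that zero] by simp
  \<comment> \<open>Negation reverses the word: \<open>- (t + y)\<close> is
    \<open>- y + - t\<close>. Hence \<open>add\<close> is used together with the symmetry of
    \<open>S\<close>.\<close>
  have neg: "- y \<in> U" if "y \<in> U" for y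
  proof -
    have "(0, y) \<in> E\<^sup>*" using that by (simp add: U_def)
    then show ?thesis
      by induction (use zero add SU S(2) in \<open>auto simp: E_def minus_add simp del: add_uminus_conv_diff\<close>)
  qed
  have "is_subgroup U" unfolding is_subgroup_def using zero add neg by blast
  moreover have "S0 \<subseteq> U" using SU by (auto simp: S_def)
  ultimately have "is_subgroup hull S0 \<subseteq> U" by (rule hull_minimal[rotated])
  then have "infinite (E\<^sup>* `` {0})" using S0(2) finite_subset unfolding U_def by blast
  with konig_ray[of E 0] S(1) obtain x :: "nat \<Rightarrow> 'g" where x: "inj x" "\<And>n. (x n, x (Suc n)) \<in> E"
    unfolding E by auto
  have "x (Suc n) - x n \<in> S" for n using x(2)[of n] by (auto simp: E_def)
  with x(1) S(1) show ?thesis by blast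
qed

subsection \<open>Partial permutation operators\<close>

text \<open>
  Partial permutations act by pullback, so the basis vector at \<open>y\<close> goes to the one at \<open>x\<close> if
  \<open>\<phi> x = Some y\<close>. The operator is unspecified unless \<open>\<phi>\<close> is injective on its domain.
\<close>

definition pperm :: "('x \<Rightarrow> 'x option) \<Rightarrow> 'x bop" where
  "pperm \<phi> = (SOME T. \<forall>v x. ell2_apply (bop_apply T v) x =
     (case \<phi> x of None \<Rightarrow> 0 | Some y \<Rightarrow> ell2_apply v y))"

text \<open>By injectivity each coordinate of \<open>v\<close> is read at most once, so the pullback
  does not increase norms and an operator with these coordinates exists.\<close>

lemma
  assumes inj: "inj_on \<phi> (dom \<phi>)"
  shows pperm_apply: "ell2_apply (bop_apply (pperm \<phi>) v) x =
      (case \<phi> x of None \<Rightarrow> 0 | Some y \<Rightarrow> ell2_apply v y)"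
    and norm_pperm_le: "norm (pperm \<phi>) \<le> 1"
proof -
  define h where "h v x = (case \<phi> x of None \<Rightarrow> 0 | Some y \<Rightarrow> ell2_apply v y)" for v x
  have fin: "(\<Sum>x\<in>F. (cmod (h v x))\<^sup>2) \<le> (1 * norm v)\<^sup>2" if F: "finite F" for F v
  proof -
    have "(\<Sum>x\<in>F. (cmod (h v x))\<^sup>2) = (\<Sum>x\<in>F \<inter> dom \<phi>. (cmod (ell2_apply v (the (\<phi> x))))\<^sup>2)"
      by (rule sum.mono_neutral_cong_right) (use F in \<open>auto simp: h_def split: option.splits\<close>)
    also have "\<dots> = (\<Sum>y\<in>(the \<circ> \<phi>) ` (F \<inter> dom \<phi>). (cmod (ell2_apply v y))\<^sup>2)"
      using inj by (subst sum.reindex) (auto simp: inj_on_def intro!: sum.cong, metis domI option.sel)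
    also have "\<dots> \<le> (norm v)\<^sup>2" by (rule finite_sum_le_norm_ell2) (use F in auto)
    finally show ?thesis by simp
  qed
  define f where "f v = Abs_ell2 (h v)" for v
  have f: "ell2_apply (f v) = h v" for v
    unfolding f_def using square_summable_boundedI[OF fin] by (simp add: Abs_ell2_inverse)
  have fb: "norm (f v) \<le> 1 * norm v" for v
    by (rule norm_ell2_boundedI) (use fin in \<open>auto simp: f\<close>)
  have "\<exists>T. \<forall>v. bop_apply T v = f v"
  proof (rule bop_exists[OF _ _ fb])
    show "f (u + v) = f u + f v" for u v
      by (rule ell2_eqI) (simp add: f h_def plus_ell2.rep_eq split: option.split)
    show "f (c *\<^sub>C v) = c *\<^sub>C f v" for c v
      by (rule ell2_eqI) (simp add: f h_def scaleC.rep_eq split: option.split)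
  qed
  then have "\<exists>T. \<forall>v x. ell2_apply (bop_apply T v) x = (case \<phi> x of None \<Rightarrow> 0 | Some y \<Rightarrow> ell2_apply v y)"
    unfolding h_def[symmetric] f[symmetric] by metis
  from someI_ex[OF this]
  show *: "ell2_apply (bop_apply (pperm \<phi>) v) x =
      (case \<phi> x of None \<Rightarrow> 0 | Some y \<Rightarrow> ell2_apply v y)" for v x
    unfolding pperm_def by blast
  have "bop_apply (pperm \<phi>) v = f v" for v by (rule ell2_eqI) (simp add: * f h_def)
  then show "norm (pperm \<phi>) \<le> 1"
    using fb by (simp add: norm_bop.rep_eq bop_apply.rep_eq norm_blinfun_bound)
qed

text \<open>The two graphs are converse to each other, which forces both maps to be injective. The
  relation describes adjoints of partial permutation operators.\<close>

definition inverse_pmaps :: "('x \<Rightarrow> 'x option) \<Rightarrow> ('x \<Rightarrow> 'x option) \<Rightarrow> bool" where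
  "inverse_pmaps \<phi> \<psi> \<longleftrightarrow> (\<forall>x y. \<phi> x = Some y \<longleftrightarrow> \<psi> y = Some x)"

lemma inverse_pmaps_sym: "inverse_pmaps \<phi> \<psi> \<Longrightarrow> inverse_pmaps \<psi> \<phi>"
  unfolding inverse_pmaps_def by blast

lemma inverse_pmaps_inj: "inverse_pmaps \<phi> \<psi> \<Longrightarrow> inj_on \<phi> (dom \<phi>)"
proof (rule inj_onI)
  fix x x' assume *: "inverse_pmaps \<phi> \<psi>" "x \<in> dom \<phi>" "\<phi> x = \<phi> x'"
  from *(2) obtain y where "\<phi> x = Some y" by blast
  with *(3) have "\<phi> x = Some y" "\<phi> x' = Some y" by simp_all
  then have "\<psi> y = Some x" "\<psi> y = Some x'" using *(1) unfolding inverse_pmaps_def by blast+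
  then show "x = x'" by simp
qed

text \<open>Written with a partial identity so that it inherits norm bound, adjoint and compactness
  from \<open>pperm\<close>.\<close>

definition coord_proj :: "'x set \<Rightarrow> 'x bop" where
  "coord_proj A = pperm (\<lambda>x. if x \<in> A then Some x else None)"

lemma inverse_pmaps_coord_proj:
  "inverse_pmaps (\<lambda>x. if x \<in> A then Some x else None) (\<lambda>x. if x \<in> A then Some x else None)"
  unfolding inverse_pmaps_def by auto

lemma inj_on_partial_id:
  "inj_on (\<lambda>x. if x \<in> A then Some x else None) (dom (\<lambda>x. if x \<in> A then Some x else None))"
  by (auto intro: inj_onI split: if_splits)

lemma coord_proj_apply:
  "ell2_apply (bop_apply (coord_proj A) v) x = (if x \<in> A then ell2_apply v x else 0)"
  unfolding coord_proj_def
  by (subst pperm_apply[OF inj_on_partial_id]) simp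

text \<open>Coordinate \<open>y\<close> of the adjoint is an inner product with the image of
  \<open>unit_vec y\<close>, and that image is \<open>unit_vec x\<close> if
  \<open>\<psi> y = Some x\<close> and \<open>0\<close> otherwise.\<close>

lemma star_pperm:
  fixes \<phi> :: "'x \<Rightarrow> 'x option"
  assumes "inverse_pmaps \<phi> \<psi>"
  shows "star (pperm \<phi>) = pperm \<psi>"
proof (intro bop_eqI ell2_eqI)
  fix v :: "'x ell2" and y
  note inj = inverse_pmaps_inj[OF assms] inverse_pmaps_inj[OF inverse_pmaps_sym[OF assms]]
  have *: "bop_apply (pperm \<phi>) (unit_vec y) = (case \<psi> y of None \<Rightarrow> 0 | Some x \<Rightarrow> unit_vec x)"
  proof (rule ell2_eqI)
    fix x
    have "\<phi> x = Some y \<longleftrightarrow> \<psi> y = Some x" using assms unfolding inverse_pmaps_def by blast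
    then show "ell2_apply (bop_apply (pperm \<phi>) (unit_vec y)) x =
        ell2_apply (case \<psi> y of None \<Rightarrow> 0 | Some x \<Rightarrow> unit_vec x) x"
      by (auto simp: pperm_apply[OF inj(1)] unit_vec.rep_eq zero_ell2.rep_eq split: option.splits)
  qed
  have "cinner 0 v = 0" using cinner_add_left[of 0 0 v] by simp
  moreover have "ell2_apply (bop_apply (star (pperm \<phi>)) v) y = cinner (bop_apply (pperm \<phi>) (unit_vec y)) v"
    by (simp add: cinner_star_bop cinner_unit_vec)
  ultimately show "ell2_apply (bop_apply (star (pperm \<phi>)) v) y = ell2_apply (bop_apply (pperm \<psi>) v) y"
    by (simp add: * pperm_apply[OF inj(2)] cinner_unit_vec split: option.split)
qed

lemma pperm_mult_inverse:
  assumes "inverse_pmaps \<phi> \<psi>"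
  shows "pperm \<phi> * pperm \<psi> = coord_proj (dom \<phi>)"
proof (intro bop_eqI ell2_eqI)
  note inj = inverse_pmaps_inj[OF assms] inverse_pmaps_inj[OF inverse_pmaps_sym[OF assms]]
  have \<psi>: "\<psi> y = Some x" if "\<phi> x = Some y" for x y
    using assms that unfolding inverse_pmaps_def by blast
  show "ell2_apply (bop_apply (pperm \<phi> * pperm \<psi>) v) x = ell2_apply (bop_apply (coord_proj (dom \<phi>)) v) x" for v x
    by (cases "\<phi> x") (auto simp: pperm_apply[OF inj(1)] pperm_apply[OF inj(2)] coord_proj_apply \<psi>)
qed

lemma star_coord_proj: "star (coord_proj A) = coord_proj A"
  unfolding coord_proj_def by (rule star_pperm) (rule inverse_pmaps_coord_proj)

lemma coord_proj_mult: "coord_proj A * coord_proj B = coord_proj (A \<inter> B)"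
  by (intro bop_eqI ell2_eqI) (simp add: coord_proj_apply)

lemma coord_proj_empty: "coord_proj {} = 0"
  by (intro bop_eqI ell2_eqI) (simp add: coord_proj_apply zero_ell2.rep_eq)

lemma coord_proj_Un: "A \<inter> B = {} \<Longrightarrow> coord_proj (A \<union> B) = coord_proj A + coord_proj B"
  by (intro bop_eqI ell2_eqI) (auto simp: coord_proj_apply plus_ell2.rep_eq)

lemma coord_proj_Diff: "B \<subseteq> A \<Longrightarrow> coord_proj A - coord_proj B = coord_proj (A - B)"
  by (intro bop_eqI ell2_eqI) (auto simp: coord_proj_apply minus_ell2.rep_eq)

lemma coord_proj_eq_0_iff: "coord_proj A = 0 \<longleftrightarrow> A = {}"
proof
  show "A = {}" if "coord_proj A = 0"
  proof (rule equals0I)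
    fix x assume "x \<in> A"
    then have "ell2_apply (bop_apply (coord_proj A) (unit_vec x)) x = 1"
      by (simp add: coord_proj_apply unit_vec.rep_eq)
    then show False using that by (simp add: zero_ell2.rep_eq)
  qed
qed (simp add: coord_proj_empty)

lemma is_projection_coord_proj: "is_projection (coord_proj A)"
  by (simp add: is_projection_def star_coord_proj coord_proj_mult)

lemma projection_in_positive_cone: "is_projection p \<Longrightarrow> p \<in> A \<Longrightarrow> p \<in> positive_cone A"
  unfolding is_projection_def positive_cone_def by (intro CollectI exI[of _ p]) simp

text \<open>The operator has finite rank: the image of the unit ball lies in a sum of discs, one for
  each basis vector indexed by \<open>dom \<phi>\<close>. Such a sum is compact by induction on the
  number of discs.\<close>

lemma compact_op_pperm:
  assumes inj: "inj_on \<phi> (dom \<phi>)" and fin: "finite (dom \<phi>)"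
  shows "compact_op (pperm \<phi>)"
proof -
  define a where "a x v = (case \<phi> x of None \<Rightarrow> 0 | Some y \<Rightarrow> ell2_apply v y)" for x v
  have a: "cmod (a x v) \<le> norm v" for x v
    by (auto simp: a_def cmod_ell2_apply_le split: option.split)
  have "\<exists>K. compact K \<and> (\<forall>v\<in>cball 0 1. (\<Sum>x\<in>D. a x v *\<^sub>C unit_vec x) \<in> K)" if "finite D" for D
    using that
  proof (induction D rule: finite_induct)
    case empty
    show ?case by (rule exI[of _ "{0}"]) simp
  next
    case (insert x D)
    then obtain K where K: "compact K" "\<And>v. v \<in> cball 0 1 \<Longrightarrow> (\<Sum>x\<in>D. a x v *\<^sub>C unit_vec x) \<in> K"
      by blast
    have "bounded_linear (\<lambda>c. c *\<^sub>C unit_vec x)"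
    proof (rule bounded_linear_intro[where K = "norm (unit_vec x)"])
      show "(c + d) *\<^sub>C unit_vec x = c *\<^sub>C unit_vec x + d *\<^sub>C unit_vec x" for c d
        by (rule ell2_eqI) (simp add: scaleC.rep_eq plus_ell2.rep_eq distrib_right)
      show "(r *\<^sub>R c) *\<^sub>C unit_vec x = r *\<^sub>R (c *\<^sub>C unit_vec x)" for r c
        by (simp add: scaleR_scaleC scaleC_scaleC scaleR_conv_of_real)
    qed (simp add: norm_scaleC)
    then have "compact ((\<lambda>c. c *\<^sub>C unit_vec x) ` cball (0 :: complex) 1)"
      by (intro compact_continuous_image linear_continuous_on compact_cball)
    then have "compact {u + w | u w. u \<in> (\<lambda>c. c *\<^sub>C unit_vec x) ` cball (0 :: complex) 1 \<and> w \<in> K}"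
      using K(1) by (rule compact_sums)
    moreover have "(\<Sum>x\<in>insert x D. a x v *\<^sub>C unit_vec x) \<in>
        {u + w | u w. u \<in> (\<lambda>c. c *\<^sub>C unit_vec x) ` cball (0 :: complex) 1 \<and> w \<in> K}"
      if v: "v \<in> cball 0 1" for v
    proof -
      have "a x v \<in> cball 0 1" using order_trans[OF a[of x v]] v by simp
      then show ?thesis using insert.hyps K(2)[OF v] by (simp, intro exI conjI) (auto intro: imageI)
    qed
    ultimately show ?case by blast
  qed
  from this[OF fin] obtain K where K: "compact K"
      "\<And>v. v \<in> cball 0 1 \<Longrightarrow> (\<Sum>x\<in>dom \<phi>. a x v *\<^sub>C unit_vec x) \<in> K" by blast
  have "bop_apply (pperm \<phi>) v = (\<Sum>x\<in>dom \<phi>. a x v *\<^sub>C unit_vec x)" for v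
  proof (rule ell2_eqI)
    fix z
    have "ell2_apply (\<Sum>x\<in>dom \<phi>. a x v *\<^sub>C unit_vec x) z = (\<Sum>x\<in>dom \<phi>. if z = x then a x v else 0)"
      unfolding ell2_apply_sum by (rule sum.cong) (auto simp: scaleC.rep_eq unit_vec.rep_eq)
    also have "\<dots> = ell2_apply (bop_apply (pperm \<phi>) v) z"
      using fin by (auto simp: pperm_apply[OF inj] a_def domIff split: option.split)
    finally show "ell2_apply (bop_apply (pperm \<phi>) v) z = ell2_apply (\<Sum>x\<in>dom \<phi>. a x v *\<^sub>C unit_vec x) z" ..
  qed
  then have "closure (bop_apply (pperm \<phi>) ` cball 0 1) \<subseteq> K"
    using K by (intro closure_minimal compact_imp_closed) auto
  then show ?thesis unfolding compact_op_def
    using compact_Int_closed[OF K(1), of "closure (bop_apply (pperm \<phi>) ` cball 0 1)"]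
    by (simp add: inf.absorb2)
qed

lemma pperm_in_linf_compact:
  assumes "\<And>s. inj_on (\<theta> s) (dom (\<theta> s))" "\<And>s. finite (dom (\<theta> s))"
  shows "(\<lambda>s. pperm (\<theta> s)) \<in> linf_compact"
proof -
  have "\<forall>s. compact_op (pperm (\<theta> s))" "\<forall>s. norm (pperm (\<theta> s)) \<le> 1"
    by (intro allI compact_op_pperm norm_pperm_le assms)+
  then show ?thesis by (auto simp: linf_compact_def bounded_iff)
qed

lemma coord_proj_in_linf_compact:
  assumes "\<And>s. finite (B s)"
  shows "(\<lambda>s. coord_proj (B s)) \<in> linf_compact"
  unfolding coord_proj_def
proof (rule pperm_in_linf_compact)
  show "inj_on (\<lambda>x. if x \<in> B s then Some x else None) (dom (\<lambda>x. if x \<in> B s then Some x else None))" for s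
    by (rule inj_on_partial_id)
  show "finite (dom (\<lambda>x. if x \<in> B s then Some x else None))" for s
    by (rule finite_subset[OF _ assms[of s]]) (auto split: if_splits)
qed

subsection \<open>Partial permutations in the Roe algebra\<close>

lemma roe_embed_apply:
  "f \<in> linf_compact \<Longrightarrow> ell2_apply (bop_apply (roe_embed f) \<xi>) (s, r, i) =
     ell2_apply (bop_apply (f (s + r)) (slice (slice \<xi> s) r)) i"
  by (metis slice_roe_embed slice_apply)

text \<open>The first coordinate comes from the regular representation and the other two from
  \<open>block_diag\<close>. At \<open>(s, r)\<close> the embedded function acts through its value
  at \<open>s + r\<close>.\<close>

lemma roe_embed_coord_proj:
  fixes B :: "'g::group_add \<Rightarrow> nat set"
  assumes "\<And>s. finite (B s)"
  shows "roe_embed (\<lambda>s. coord_proj (B s)) = coord_proj {(s, r, i). i \<in> B (s + r)}"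
proof (intro bop_eqI ell2_eqI)
  fix \<xi> and z :: "'g \<times> 'g \<times> nat"
  obtain s r i where "z = (s, r, i)" by (metis prod_cases3)
  then show "ell2_apply (bop_apply (roe_embed (\<lambda>s. coord_proj (B s))) \<xi>) z =
      ell2_apply (bop_apply (coord_proj {(s, r, i). i \<in> B (s + r)}) \<xi>) z"
    by (simp add: roe_embed_apply coord_proj_in_linf_compact assms coord_proj_apply slice_apply)
qed

lemma sum_in_roe_algebra:
  assumes "finite F" "\<And>t. t \<in> F \<Longrightarrow> a t \<in> linf_compact"
  shows "(\<Sum>t\<in>F. roe_embed (a t) * shift t) \<in> roe_algebra"
  unfolding roe_algebra_def reduced_crossed_product_def roe_embed_def[symmetric]
  by (rule subsetD[OF closure_subset]) (use assms in blast)

text \<open>Group the points \<open>y = s + r\<close> by the translation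
  \<open>t = \<sigma> y\<close>. Each group contributes one term
  \<open>roe_embed (a t) * shift t\<close>, and finitely many \<open>t\<close> occur.\<close>

lemma pperm_in_roe_algebra:
  fixes \<theta> :: "'g::group_add \<Rightarrow> nat \<Rightarrow> nat option" and \<sigma> :: "'g \<Rightarrow> 'g"
  assumes \<theta>: "\<And>y. inj_on (\<theta> y) (dom (\<theta> y))" "\<And>y. finite (dom (\<theta> y))"
    and S: "finite S" "\<And>y. \<theta> y \<noteq> Map.empty \<Longrightarrow> \<sigma> y \<in> S"
    and \<phi>: "\<And>s r i. \<phi> (s, r, i) = map_option (\<lambda>j. (- \<sigma> (s + r) + s, r, j)) (\<theta> (s + r) i)"
      "inj_on \<phi> (dom \<phi>)"
  shows "pperm \<phi> \<in> roe_algebra"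
proof -
  define \<eta> where "\<eta> t y = (if \<sigma> y = t then \<theta> y else Map.empty)" for t y
  define a where "a t = (\<lambda>y. pperm (\<eta> t y))" for t
  have \<eta>: "inj_on (\<eta> t y) (dom (\<eta> t y))" "finite (dom (\<eta> t y))" for t y
    using \<theta> by (auto simp: \<eta>_def)
  have a: "a t \<in> linf_compact" for t
    unfolding a_def using \<eta> by (rule pperm_in_linf_compact)
  have "pperm \<phi> = (\<Sum>t\<in>S. roe_embed (a t) * shift t)"
  proof (intro bop_eqI ell2_eqI)
    fix \<xi> :: "('g \<times> 'g \<times> nat) ell2" and z :: "'g \<times> 'g \<times> nat"
    obtain s r i where z: "z = (s, r, i)" by (metis prod_cases3)
    have sum: "bop_apply (\<Sum>t\<in>F. T t) \<xi> = (\<Sum>t\<in>F. bop_apply (T t) \<xi>)" for F :: "'g set" and T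
      by (induction F rule: infinite_finite_induct) auto
    have "ell2_apply (bop_apply (roe_embed (a t)) \<zeta>) (s, r, i) =
        (case \<eta> t (s + r) i of None \<Rightarrow> 0 | Some j \<Rightarrow> ell2_apply \<zeta> (s, r, j))" for t \<zeta>
      by (subst roe_embed_apply[OF a]) (simp add: a_def pperm_apply[OF \<eta>(1)] slice_apply split: option.split)
    then have "ell2_apply (bop_apply (\<Sum>t\<in>S. roe_embed (a t) * shift t) \<xi>) z =
        (\<Sum>t\<in>S. case \<eta> t (s + r) i of None \<Rightarrow> 0 | Some j \<Rightarrow> ell2_apply \<xi> (- t + s, r, j))"
      by (simp add: sum ell2_apply_sum z shift_apply cong: option.case_cong)
    also have "\<dots> = (\<Sum>t\<in>S. if \<sigma> (s + r) = t
        then case \<theta> (s + r) i of None \<Rightarrow> 0 | Some j \<Rightarrow> ell2_apply \<xi> (- \<sigma> (s + r) + s, r, j) else 0)"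
      by (rule sum.cong) (auto simp: \<eta>_def)
    also have "\<dots> = (case \<theta> (s + r) i of None \<Rightarrow> 0 | Some j \<Rightarrow> ell2_apply \<xi> (- \<sigma> (s + r) + s, r, j))"
    \<comment> \<open>Only where \<open>\<theta> (s + r)\<close> is nonempty is
      \<open>\<sigma> (s + r)\<close> known to lie in \<open>S\<close>; if it is undefined at
      \<open>i\<close>, every summand vanishes.\<close>
    proof (cases "\<theta> (s + r) i")
      case None
      then show ?thesis by (intro trans[OF sum.neutral]) auto
    next
      case (Some j)
      then have "\<sigma> (s + r) \<in> S" by (intro S(2)) auto
      then show ?thesis using S(1) by simp
    qed
    also have "\<dots> = ell2_apply (bop_apply (pperm \<phi>) \<xi>) z"
      by (simp add: z pperm_apply \<phi> split: option.split)
    finally show "ell2_apply (bop_apply (pperm \<phi>) \<xi>) z =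
        ell2_apply (bop_apply (\<Sum>t\<in>S. roe_embed (a t) * shift t) \<xi>) z" ..
  qed
  then show ?thesis using sum_in_roe_algebra[OF S(1), of a] a by simp
qed

lemma roe_embed_in_roe_algebra:
  assumes "f \<in> linf_compact"
  shows "roe_embed f \<in> roe_algebra"
proof -
  have "shift 0 = (1 :: ('a \<times> 'a \<times> nat) bop)"
    by (intro bop_eqI ell2_eq_sliceI) (simp add: slice_shift)
  then show ?thesis using sum_in_roe_algebra[of "{0}" "\<lambda>_. f"] assms by simp
qed

lemma coord_proj_in_roe_algebra:
  assumes "\<And>s. finite (B s)"
  shows "coord_proj {(s, r, i). i \<in> B (s + r)} \<in> roe_algebra"
  using roe_embed_in_roe_algebra[OF coord_proj_in_linf_compact[OF assms]]
  by (simp only: roe_embed_coord_proj[OF assms])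

section \<open>Murray-von Neumann equivalence from partial permutations\<close>

lemma inverse_pmaps_exists:
  assumes "inj_on \<psi> (dom \<psi>)"
  shows "\<exists>\<phi>. inverse_pmaps \<phi> \<psi>"
proof (intro exI)
  show "inverse_pmaps (\<lambda>y. if y \<in> ran \<psi> then Some (SOME x. \<psi> x = Some y) else None) \<psi>"
    unfolding inverse_pmaps_def
  proof (intro allI)
    fix y x
    have "\<psi> (SOME x. \<psi> x = Some y) = Some y" if "y \<in> ran \<psi>"
      using that unfolding ran_def by (auto intro: someI)
    moreover have "u = x" if "\<psi> u = Some y" "\<psi> x = Some y" for u
      by (rule inj_onD[OF assms]) (use that in auto)
    ultimately show "(if y \<in> ran \<psi> then Some (SOME x. \<psi> x = Some y) else None) = Some x \<longleftrightarrow> \<psi> x = Some y"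
      by (auto simp: ranI)
  qed
qed

lemma inverse_pmaps_dom: "inverse_pmaps \<phi> \<psi> \<Longrightarrow> dom \<phi> = ran \<psi>"
  unfolding inverse_pmaps_def dom_def ran_def by blast

text \<open>The partial isometry is \<open>pperm \<psi>\<close> itself. Since it acts by pullback,
  its source projection belongs to \<open>ran \<psi>\<close> and its range projection to
  \<open>dom \<psi>\<close>.\<close>

lemma mvn_equivalent_pperm:
  assumes inj: "inj_on \<psi> (dom \<psi>)" and "pperm \<psi> \<in> A"
  shows "mvn_equivalent A (coord_proj (ran \<psi>)) (coord_proj (dom \<psi>))"
proof -
  obtain \<phi> where \<phi>: "inverse_pmaps \<phi> \<psi>" using inverse_pmaps_exists[OF inj] by blast
  note \<psi> = inverse_pmaps_sym[OF \<phi>]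
  have "star (pperm \<psi>) * pperm \<psi> = coord_proj (ran \<psi>)" "pperm \<psi> * star (pperm \<psi>) = coord_proj (dom \<psi>)"
    unfolding star_pperm[OF \<psi>] by (simp_all add: pperm_mult_inverse[OF \<phi>] pperm_mult_inverse[OF \<psi>] inverse_pmaps_dom[OF \<phi>])
  then show ?thesis using assms(2) unfolding mvn_equivalent_def by blast
qed

subsection \<open>Traces and rank functions\<close>

lemma trace_eq_mvn: "is_trace A \<tau> \<Longrightarrow> mvn_equivalent A p q \<Longrightarrow> \<tau> p = \<tau> q"
  unfolding is_trace_def mvn_equivalent_def by metis

lemma is_projection_fun: "(\<And>s. is_projection (p s)) \<Longrightarrow> is_projection p"
  by (auto simp: is_projection_def)

text \<open>The ranks may be unbounded in \<open>s\<close>: every value still has finite rank and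
  norm at most \<open>1\<close>.\<close>

definition rank_proj :: "('g \<Rightarrow> nat) \<Rightarrow> 'g \<Rightarrow> nat bop" where
  "rank_proj m = (\<lambda>s. coord_proj {..<m s})"

lemma rank_proj_in_linf_compact: "rank_proj m \<in> linf_compact"
  unfolding rank_proj_def by (rule coord_proj_in_linf_compact) simp

lemma is_projection_rank_proj: "is_projection (rank_proj m)"
  unfolding rank_proj_def by (intro is_projection_fun is_projection_coord_proj)

lemma left_translate_rank_proj: "left_translate t (rank_proj m) = rank_proj (\<lambda>s. m (- t + s))"
  by (simp add: left_translate_def rank_proj_def)

context
  fixes \<tau> :: "('g \<Rightarrow> nat bop) \<Rightarrow> ennreal"
  assumes trace: "is_trace linf_compact \<tau>"
begin

text \<open>Homogeneity at the scalar \<open>0\<close>; in \<open>ennreal\<close> the product with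
  \<open>0\<close> vanishes even at an infinite value.\<close>

lemma trace_rank_proj_0: "\<tau> (rank_proj (\<lambda>_. 0)) = 0"
proof -
  have "rank_proj (\<lambda>_. 0) = (0 *\<^sub>R rank_proj (\<lambda>_. 0) :: 'g \<Rightarrow> nat bop)"
    by (rule ext) (simp add: rank_proj_def coord_proj_empty)
  moreover have "\<tau> (0 *\<^sub>R rank_proj (\<lambda>_. 0)) = ennreal 0 * \<tau> (rank_proj (\<lambda>_. 0))"
    using trace projection_in_positive_cone[OF is_projection_rank_proj rank_proj_in_linf_compact]
    unfolding is_trace_def by blast
  ultimately show ?thesis by simp
qed

text \<open>The coordinates from \<open>m s\<close> up to \<open>m s + n s\<close> are moved onto
  the first \<open>n s\<close> ones by a partial isometry at each \<open>s\<close>, so the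
  complement \<open>q\<close> of \<open>rank_proj m\<close> has the trace of
  \<open>rank_proj n\<close>.\<close>

lemma trace_rank_proj_add:
  "\<tau> (rank_proj (\<lambda>s. m s + n s)) = \<tau> (rank_proj m) + \<tau> (rank_proj n)"
proof -
  define q where "q s = coord_proj {m s..<m s + n s}" for s
  define \<psi> where "\<psi> s i = (if i < n s then Some (m s + i) else None)" for s i
  have dom: "dom (\<psi> s) = {..<n s}" for s by (auto simp: \<psi>_def split: if_splits)
  have ran: "ran (\<psi> s) = {m s..<m s + n s}" for s
  proof (intro set_eqI iffI)
    show "j \<in> {m s..<m s + n s}" if "j \<in> ran (\<psi> s)" for j
      using that by (auto simp: \<psi>_def ran_def split: if_splits)
    show "j \<in> ran (\<psi> s)" if "j \<in> {m s..<m s + n s}" for j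
      by (rule ranI[of _ "j - m s"]) (use that in \<open>auto simp: \<psi>_def\<close>)
  qed
  have inj: "inj_on (\<psi> s) (dom (\<psi> s))" for s
    by (rule inj_onI) (auto simp: \<psi>_def split: if_splits)
  have q: "q \<in> linf_compact" "is_projection q"
    unfolding q_def by (auto intro: coord_proj_in_linf_compact is_projection_fun is_projection_coord_proj)
  have w: "(\<lambda>s. pperm (\<psi> s)) \<in> linf_compact"
    by (rule pperm_in_linf_compact[OF inj]) (simp add: dom)
  have "star (pperm (\<psi> s)) * pperm (\<psi> s) = q s \<and> pperm (\<psi> s) * star (pperm (\<psi> s)) = rank_proj n s" for s
  proof -
    obtain \<phi> where \<phi>: "inverse_pmaps \<phi> (\<psi> s)" using inverse_pmaps_exists[OF inj] by blast
    note \<psi> = inverse_pmaps_sym[OF \<phi>]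
    show ?thesis
      unfolding star_pperm[OF \<psi>] pperm_mult_inverse[OF \<phi>] pperm_mult_inverse[OF \<psi>] inverse_pmaps_dom[OF \<phi>] q_def rank_proj_def dom ran
      by simp
  qed
  then have "mvn_equivalent linf_compact q (rank_proj n)"
    unfolding mvn_equivalent_def by (intro bexI[OF _ w]) (auto simp: fun_eq_iff)
  then have "\<tau> q = \<tau> (rank_proj n)" by (rule trace_eq_mvn[OF trace])
  moreover have "rank_proj (\<lambda>s. m s + n s) = rank_proj m + q"
  proof (rule ext)
    fix s
    have "{..<m s + n s} = {..<m s} \<union> {m s..<m s + n s}" by auto
    then show "rank_proj (\<lambda>s. m s + n s) s = (rank_proj m + q) s"
      by (simp add: rank_proj_def q_def coord_proj_Un ivl_disj_int)
  qed
  moreover have "\<tau> (rank_proj m + q) = \<tau> (rank_proj m) + \<tau> q"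
    using trace q projection_in_positive_cone[OF is_projection_rank_proj rank_proj_in_linf_compact]
      projection_in_positive_cone[of q]
    unfolding is_trace_def by blast
  ultimately show ?thesis by simp
qed

lemma trace_rank_proj_mult: "\<tau> (rank_proj (\<lambda>s. c * m s)) = of_nat c * \<tau> (rank_proj m)"
proof (induction c)
  case (Suc c)
  show ?case using trace_rank_proj_add[of m "\<lambda>s. c * m s"] by (simp add: Suc distrib_right)
qed (simp add: trace_rank_proj_0)

lemma trace_rank_proj_sum: "\<tau> (rank_proj (\<lambda>s. \<Sum>t\<in>S. m t s)) = (\<Sum>t\<in>S. \<tau> (rank_proj (m t)))"
  by (induction S rule: infinite_finite_induct) (auto simp: trace_rank_proj_0 trace_rank_proj_add)

lemma trace_rank_proj_mono:
  assumes "\<And>s. m s \<le> n s"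
  shows "\<tau> (rank_proj m) \<le> \<tau> (rank_proj n)"
proof -
  have "n = (\<lambda>s. m s + (n s - m s))" using assms by auto
  then have "\<tau> (rank_proj n) = \<tau> (rank_proj m) + \<tau> (rank_proj (\<lambda>s. n s - m s))"
    by (metis trace_rank_proj_add)
  then show ?thesis by simp
qed

end

section \<open>Traces on the orbit of a rank projection\<close>

lemma trace_orbit_unbounded_or_zero:
  fixes f :: "'g::group_add \<Rightarrow> nat"
  assumes trace: "is_trace linf_compact \<tau>" and "card S < c"
    and f: "\<And>y. c * f y \<le> (\<Sum>t\<in>S. f (t + y))"
  shows "(SUP t. \<tau> (left_translate t (rank_proj f))) = \<infinity> \<or>
    (\<forall>t. \<tau> (left_translate t (rank_proj f)) = 0)"
proof -
  define T where "T h = \<tau> (left_translate h (rank_proj f))" for h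
  define M where "M = (SUP h. T h)"
  have "of_nat c * T h \<le> of_nat (card S) * M" for h
  proof -
    have "of_nat c * T h = \<tau> (rank_proj (\<lambda>s. c * f (- h + s)))"
      by (simp add: T_def left_translate_rank_proj trace_rank_proj_mult[OF trace])
    also have "\<dots> \<le> \<tau> (rank_proj (\<lambda>s. \<Sum>t\<in>S. f (t + (- h + s))))"
      by (rule trace_rank_proj_mono[OF trace f])
    also have "\<dots> = (\<Sum>t\<in>S. \<tau> (rank_proj (\<lambda>s. f (t + (- h + s)))))"
      by (rule trace_rank_proj_sum[OF trace])
    \<comment> \<open>Precomposing with left addition of \<open>t\<close> moves from the orbit point
      \<open>h\<close> to \<open>h + - t\<close>, so each summand is again at most
      \<open>M\<close>.\<close>
    also have "\<dots> = (\<Sum>t\<in>S. T (h + - t))"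
      by (simp only: T_def left_translate_rank_proj minus_add minus_minus add.assoc)
    also have "\<dots> \<le> (\<Sum>t\<in>S. M)" unfolding M_def by (intro sum_mono SUP_upper) simp
    finally show ?thesis by simp
  qed
  then have "(SUP h. of_nat c * T h) \<le> of_nat (card S) * M" by (rule SUP_least)
  then have le: "of_nat c * M \<le> of_nat (card S) * M" by (simp add: SUP_mult_left_ennreal M_def)
  \<comment> \<open>A finite \<open>M\<close> turns \<open>le\<close> into an inequality of reals,
    which \<open>card S < c\<close> allows only for \<open>0\<close>.\<close>
  have "M = 0" if "M \<noteq> \<infinity>"
  proof -
    obtain x where x: "M = ennreal x" "0 \<le> x" using \<open>M \<noteq> \<infinity>\<close> by (cases M) (auto simp: infinity_ennreal_def)
    have "real c * x \<le> real (card S) * x"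
      using le x by (simp add: ennreal_of_nat_eq_real_of_nat ennreal_mult[symmetric])
    moreover have "real (card S) < real c" using assms(2) by simp
    ultimately have "x = 0" using x(2) mult_strict_right_mono[of "real (card S)" "real c" x] by linarith
    then show ?thesis using x(1) by simp
  qed
  moreover have "T h \<le> M" for h unfolding M_def by (rule SUP_upper) simp
  ultimately have "M = \<infinity> \<or> (\<forall>h. T h = 0)" by (metis le_zero_eq)
  then show ?thesis by (simp add: M_def T_def)
qed

section \<open>Proper infiniteness in the Roe algebra\<close>

text \<open>Both \<open>q1\<close> and \<open>q2\<close> have the trace of \<open>p\<close>, so
  additivity gives \<open>\<tau> p = \<tau> p + (\<tau> p + \<tau> r)\<close>, which fails for the
  value \<open>1\<close>. Projections in \<open>A\<close> are positive, which supplies the order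
  relations.\<close>

lemma properly_infinite_decomposition:
  assumes "p \<in> A" "p \<noteq> 0" "is_projection p" "q1 \<in> A" "is_projection q1" "q2 \<in> A" "is_projection q2"
    and "r \<in> A" "is_projection r" "p - q1 \<in> A" "is_projection (p - q1)" "p - q2 \<in> A" "is_projection (p - q2)"
    and p: "p = q1 + q2 + r" and "q1 * q2 = 0"
    and q: "mvn_equivalent A q1 p" "mvn_equivalent A q2 p"
  shows "properly_infinite A p" and "is_trace A \<tau> \<Longrightarrow> \<tau> p \<noteq> 1"
proof -
  have pos: "q1 \<in> positive_cone A" "q2 \<in> positive_cone A" "r \<in> positive_cone A"
      "p - q1 \<in> positive_cone A" "p - q2 \<in> positive_cone A"
    by (rule projection_in_positive_cone; fact)+
  show "properly_infinite A p"
    unfolding properly_infinite_def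
    by (intro conjI bexI[of _ q1] bexI[of _ q2]) (fact assms pos)+
  assume tr: "is_trace A \<tau>"
  have add: "\<tau> (x + y) = \<tau> x + \<tau> y" if "x \<in> positive_cone A" "y \<in> positive_cone A" for x y
    using tr that unfolding is_trace_def by blast
  have "\<tau> p = \<tau> q1 + \<tau> (p - q1)" using add[OF pos(1,4)] by simp
  also have "\<tau> (p - q1) = \<tau> q2 + \<tau> r" using add[OF pos(2,3)] by (simp add: p add.assoc)
  finally have "\<tau> p = \<tau> p + (\<tau> p + \<tau> r)"
    unfolding trace_eq_mvn[OF tr q(1)] trace_eq_mvn[OF tr q(2)] .
  then show "\<tau> p \<noteq> 1"
  proof (intro notI)
    assume "\<tau> p = 1"
    with \<open>\<tau> p = \<tau> p + (\<tau> p + \<tau> r)\<close> have "(1 :: ennreal) + 0 = 1 + (1 + \<tau> r)" by simp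
    then show False by (simp only: ennreal_add_left_cancel) auto
  qed
qed

text \<open>Think of \<open>\<sigma> y + y\<close> as the successor of \<open>y\<close>. It has room
  for two disjoint blocks of \<open>f y\<close> coordinates, and injectivity prevents blocks of
  different points from meeting.\<close>

lemma properly_infinite_rank_proj:
  fixes f :: "'g::group_add \<Rightarrow> nat" and \<sigma> :: "'g \<Rightarrow> 'g"
  assumes S: "finite S" "\<And>y. f y > 0 \<Longrightarrow> \<sigma> y \<in> S"
    and inj: "inj_on (\<lambda>y. \<sigma> y + y) {y. f y > 0}"
    and le: "\<And>y. 2 * f y \<le> f (\<sigma> y + y)" and pos: "f y0 > 0"
  shows "properly_infinite roe_algebra (roe_embed (rank_proj f))"
    and "is_trace roe_algebra \<tau> \<Longrightarrow> \<tau> (roe_embed (rank_proj f)) \<noteq> 1"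
proof -
  \<comment> \<open>Block number \<open>k\<close>, counted from \<open>0\<close>, that predecessors
    \<open>y\<close> of \<open>z\<close> occupy at \<open>z\<close>. Points with
    \<open>f y = 0\<close> contribute nothing, so at most one \<open>y\<close> matters.\<close>
  define B where "B k z = {j. \<exists>y. z = \<sigma> y + y \<and> k * f y \<le> j \<and> j < k * f y + f y}" for k z
  define C where "C R = coord_proj {(s, r, i). i \<in> R (s + r)}" for R :: "'g \<Rightarrow> nat set"
  have C: "is_projection (C R)" for R unfolding C_def by (rule is_projection_coord_proj)
  have CA: "C R \<in> roe_algebra" if "\<And>z. R z \<subseteq> {..<f z}" for R
    unfolding C_def by (rule coord_proj_in_roe_algebra) (rule finite_subset[OF that], simp)
  have C_Diff: "C R - C R' = C (\<lambda>z. R z - R' z)" if "\<And>z. R' z \<subseteq> R z" for R R'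
    unfolding C_def by (subst coord_proj_Diff) (use that in \<open>auto intro: arg_cong[of _ _ coord_proj]\<close>)
  have p: "roe_embed (rank_proj f) = C (\<lambda>z. {..<f z})"
    unfolding C_def rank_proj_def by (rule roe_embed_coord_proj) simp
  have B: "B k z \<subseteq> {..<f z}" if "k < 2" for k z
  proof
    fix j assume "j \<in> B k z"
    then obtain y where y: "z = \<sigma> y + y" "j < k * f y + f y" by (auto simp: B_def)
    have "k = 0 \<or> k = 1" using that by auto
    then show "j \<in> {..<f z}" using le[of y] y by auto
  qed
  have disj: "B 0 z \<inter> B 1 z = {}" for z
  proof (rule equals0I)
    fix j assume "j \<in> B 0 z \<inter> B 1 z"
    then have "j \<in> B 0 z" "j \<in> B 1 z" by simp_all
    obtain y where y0: "z = \<sigma> y + y" "j < f y" using \<open>j \<in> B 0 z\<close> by (auto simp: B_def)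
    obtain y' where y1: "z = \<sigma> y' + y'" "f y' \<le> j" "j < f y' + f y'"
      using \<open>j \<in> B 1 z\<close> by (auto simp: B_def)
    note y = y0 y1
    then have "f y > 0" "f y' > 0" by linarith+
    then have "y = y'" using inj_onD[OF inj, of y y'] y by simp
    then show False using y by simp
  qed
  have mvn: "mvn_equivalent roe_algebra (C (B k)) (C (\<lambda>z. {..<f z}))" for k
  proof -
    define \<theta> where "\<theta> y i = (if i < f y then Some (k * f y + i) else None)" for y i
    \<comment> \<open>The domain indexes \<open>p\<close> and the range indexes block
      \<open>k\<close> at the successors. The double negation matches the form of
      \<open>pperm_in_roe_algebra\<close>, applied with \<open>- \<sigma> y\<close> and the
      negatives of \<open>S\<close>.\<close>
    define \<psi> where "\<psi> = (\<lambda>(s, r, i). map_option (\<lambda>j. (- (- \<sigma> (s + r)) + s, r, j)) (\<theta> (s + r) i))"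
    have \<psi>: "\<psi> (s, r, i) = (if i < f (s + r) then Some (\<sigma> (s + r) + s, r, k * f (s + r) + i) else None)" for s r i
      by (simp add: \<psi>_def \<theta>_def)
    have inj_\<psi>: "inj_on \<psi> (dom \<psi>)"
    proof (rule inj_onI)
      fix x x' assume x: "x \<in> dom \<psi>" "x' \<in> dom \<psi>" "\<psi> x = \<psi> x'"
      obtain s r i s' r' i' where xx: "x = (s, r, i)" "x' = (s', r', i')" by (metis prod_cases3)
      have lt: "i < f (s + r)" "i' < f (s' + r')" using x unfolding xx by (auto simp: \<psi> split: if_splits)
      then have e: "\<sigma> (s + r) + s = \<sigma> (s' + r') + s'" "r = r'" "k * f (s + r) + i = k * f (s' + r') + i'"
        using x(3) unfolding xx \<psi> by auto
      \<comment> \<open>Adding the common \<open>r\<close> on the right turns equal first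
        coordinates into equal successors, to which \<open>inj\<close> applies.\<close>
      have "\<sigma> (s + r) + (s + r) = \<sigma> (s' + r') + (s' + r')"
        using e(1,2) by (simp flip: add.assoc)
      then have "s + r = s' + r'" using inj_onD[OF inj, of "s + r" "s' + r'"] lt by simp
      then show "x = x'" using e by (simp add: xx)
    qed
    have "pperm \<psi> \<in> roe_algebra"
    proof (rule pperm_in_roe_algebra[where \<theta> = \<theta> and \<sigma> = "\<lambda>y. - \<sigma> y" and S = "uminus ` S"])
      show "inj_on (\<theta> y) (dom (\<theta> y))" for y by (rule inj_onI) (auto simp: \<theta>_def split: if_splits)
      show "finite (dom (\<theta> y))" for y
        by (rule finite_subset[of _ "{..<f y}"]) (auto simp: \<theta>_def split: if_splits)
      show "- \<sigma> y \<in> uminus ` S" if "\<theta> y \<noteq> Map.empty" for y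
      proof -
        have "f y > 0" using that by (auto simp: \<theta>_def fun_eq_iff split: if_splits)
        then show ?thesis using S(2) by simp
      qed
      show "\<psi> (s, r, i) = map_option (\<lambda>j. (- (- \<sigma> (s + r)) + s, r, j)) (\<theta> (s + r) i)" for s r i
        by (simp add: \<psi>_def)
    qed (use S(1) inj_\<psi> in auto)
    moreover have "dom \<psi> = {(s, r, i). i \<in> {..<f (s + r)}}"
      by (auto simp: \<psi> split: if_splits)
    moreover have "ran \<psi> = {(s, r, i). i \<in> B k (s + r)}"
    proof (intro set_eqI iffI)
      fix z assume "z \<in> ran \<psi>"
      then obtain s r i where "\<psi> (s, r, i) = Some z" by (auto simp: ran_def)
      then have z: "i < f (s + r)" "z = (\<sigma> (s + r) + s, r, k * f (s + r) + i)"
        by (auto simp: \<psi> split: if_splits)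
      then show "z \<in> {(s, r, i). i \<in> B k (s + r)}"
        by (auto simp: B_def add.assoc intro!: exI[of _ "s + r"])
    next
      fix z assume "z \<in> {(s, r, i). i \<in> B k (s + r)}"
      then obtain s r j y where z: "z = (s, r, j)" "s + r = \<sigma> y + y" "k * f y \<le> j" "j < k * f y + f y"
        by (auto simp: B_def)
      \<comment> \<open>Undoing the translation of the first coordinate with \<open>r\<close> fixed
        leads back to the predecessor \<open>y\<close>.\<close>
      have "- \<sigma> y + s + r = y" using z(2) by (simp add: add.assoc)
      then have "\<psi> (- \<sigma> y + s, r, j - k * f y) = Some z"
        using z by (simp add: \<psi> add.assoc[symmetric])
      then show "z \<in> ran \<psi>" by (rule ranI)
    qed
    ultimately show ?thesis using mvn_equivalent_pperm[OF inj_\<psi>] by (simp add: C_def)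
  qed
  \<comment> \<open>The coordinates outside both blocks, giving the remainder in the decomposition
    of \<open>p\<close>.\<close>
  define R where "R z = {..<f z} - B 0 z - B 1 z" for z
  have p_diff: "C (\<lambda>z. {..<f z}) - C (B k) = C (\<lambda>z. {..<f z} - B k z)" if "k < 2" for k
    by (rule C_Diff) (rule B[OF that])
  have "C (\<lambda>z. {..<f z}) - C (B 0) - C (B 1) = C R"
    unfolding p_diff[of 0, simplified] R_def by (rule C_Diff) (use B[of 1] disj in auto)
  then have sum: "C (\<lambda>z. {..<f z}) = C (B 0) + C (B 1) + C R" by (simp add: algebra_simps)
  have prod: "C (B 0) * C (B 1) = 0"
    unfolding C_def coord_proj_mult coord_proj_eq_0_iff using disj by auto
  have nz: "C (\<lambda>z. {..<f z}) \<noteq> 0"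
  proof -
    have "(y0, 0, 0) \<in> {(s, r, i). i \<in> {..<f (s + r)}}" using pos by simp
    then show ?thesis unfolding C_def coord_proj_eq_0_iff by blast
  qed
  have d: "C (\<lambda>z. {..<f z}) - C (B k) \<in> roe_algebra" "is_projection (C (\<lambda>z. {..<f z}) - C (B k))" if "k < 2" for k
    unfolding p_diff[OF that] by (auto intro!: CA C)
  have in_roe: "C (B 0) \<in> roe_algebra" "C (B 1) \<in> roe_algebra" "C R \<in> roe_algebra" "C (\<lambda>z. {..<f z}) \<in> roe_algebra"
    by (rule CA; use B[of 0] B[of 1] in \<open>auto simp: R_def\<close>)+
  have one_less_two: "(1 :: nat) < 2" by simp
  note * = properly_infinite_decomposition[OF in_roe(4) nz C in_roe(1) C in_roe(2) C in_roe(3) C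
      d[OF pos2] d[OF one_less_two] sum prod mvn mvn]
  show "properly_infinite roe_algebra (roe_embed (rank_proj f))" unfolding p by (rule *(1))
  show "\<tau> (roe_embed (rank_proj f)) \<noteq> 1" if "is_trace roe_algebra \<tau>"
    unfolding p by (rule *(2)[OF that])
qed

section \<open>Exponential ranks along a ray\<close>

theorem proposition5p12:
  assumes "\<not> locally_finite_group TYPE('g::{group_add,countable})"
  shows "\<exists>p \<in> (linf_compact :: ('g \<Rightarrow> nat bop) set).
    is_projection p \<and>
    properly_infinite roe_algebra (roe_embed p) \<and>
    (\<nexists>\<tau>. is_trace roe_algebra \<tau> \<and> \<tau> (roe_embed p) = 1) \<and>
    (\<forall>\<tau>. is_trace linf_compact \<tau> \<longrightarrow>
      (SUP t. \<tau> (left_translate t p)) = \<infinity> \<or> (\<forall>t. \<tau> (left_translate t p) = 0))"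
proof -
  obtain S :: "'g set" and x :: "nat \<Rightarrow> 'g" where S: "finite S" "inj x" "\<And>n. x (Suc n) - x n \<in> S"
    using exists_injective_ray[OF assms] by blast
  \<comment> \<open>Growth by at least \<open>2\<close> makes room for two copies at the next point;
    growth above \<open>card S\<close> decides the traces on the orbit.\<close>
  define c where "c = card S + 2"
  define f where "f y = (if y \<in> range x then c ^ inv x y else 0)" for y
  \<comment> \<open>The step to the next point of the ray. Off the ray \<open>inv x y\<close> is
    arbitrary, but there \<open>f y = 0\<close>.\<close>
  define \<sigma> where "\<sigma> y = x (Suc (inv x y)) - y" for y
  have f: "f (x n) = c ^ n" for n using S(2) by (simp add: f_def)
  have f_pos: "y \<in> range x" if "f y > 0" for y using that by (auto simp: f_def split: if_splits)
  have \<sigma>: "\<sigma> (x n) = x (Suc n) - x n" for n using S(2) by (simp add: \<sigma>_def)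
  have step: "f (\<sigma> y + y) = c * f y \<and> \<sigma> y \<in> S" if y: "f y > 0" for y
    using f_pos[OF y] f[of "Suc _"] by (auto simp: f \<sigma> S(3))
  have 1: "\<sigma> y \<in> S" if "f y > 0" for y using step[OF that] by simp
  have 2: "inj_on (\<lambda>y. \<sigma> y + y) {y. f y > 0}"
  proof (rule inj_onI)
    fix y z assume *: "y \<in> {y. f y > 0}" "z \<in> {y. f y > 0}" "\<sigma> y + y = \<sigma> z + z"
    then obtain n k where "y = x n" "z = x k" using f_pos by blast
    with *(3) S(2) show "y = z" by (simp add: \<sigma> inj_eq)
  qed
  have 3: "2 * f y \<le> f (\<sigma> y + y)" for y
    by (cases "f y > 0") (use step[of y] in \<open>auto simp: c_def\<close>)
  have 4: "f (x 0) > 0" by (simp add: f)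
  \<comment> \<open>The single summand \<open>t = \<sigma> y\<close> already equals
    \<open>c * f y\<close>.\<close>
  have 5: "c * f y \<le> (\<Sum>t\<in>S. f (t + y))" for y
  proof (cases "f y > 0")
    case True
    then show ?thesis
      using step[OF True] member_le_sum[of "\<sigma> y" S "\<lambda>t. f (t + y)"] S(1) by simp
  qed simp
  have 6: "card S < c" by (simp add: c_def)
  show ?thesis
  proof (intro bexI[of _ "rank_proj f"] conjI allI impI)
    show "is_projection (rank_proj f)" by (rule is_projection_rank_proj)
    show "properly_infinite roe_algebra (roe_embed (rank_proj f))"
      by (rule properly_infinite_rank_proj(1)[OF S(1) 1 2 3 4])
    show "\<nexists>\<tau>. is_trace roe_algebra \<tau> \<and> \<tau> (roe_embed (rank_proj f)) = 1"
      using properly_infinite_rank_proj(2)[OF S(1) 1 2 3 4] by blast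
    show "(SUP t. \<tau> (left_translate t (rank_proj f))) = \<infinity> \<or> (\<forall>t. \<tau> (left_translate t (rank_proj f)) = 0)"
      if "is_trace linf_compact \<tau>" for \<tau>
      by (rule trace_orbit_unbounded_or_zero[OF that 6 5])
    show "rank_proj f \<in> linf_compact" by (rule rank_proj_in_linf_compact)
  qed
qed

end
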